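(* Let $n=3$, $r_1,r_2,r_3\ge 2$ integers, $t\in[3]$, and $s=2$. The ideal $I^{\langle 2,t\rangle}$ of $R$ has exactly the following $2^{r_3}-1$ minimal primes: the ideal $\widetilde{I}^{\langle 2,t\rangle}$ and the monomial ideals $P^{\langle 2,t\rangle}_{\mathcal{S}^\varphi}$ with $$\mathcal{S}^\varphi=\big\{a\in\mathcal{N} : (a_1,a_2)=\varphi(a_3)\big\},$$ as $\varphi$ varies over the non-constant functions $\varphi:[r_3]\to\{(1,1),(r_1,r_2)\}$.
   Context: Notation: $[r]=\{1,\ldots,r\}$, $\mathcal{N}=[r_1]\times[r_2]\times[r_3]$, $\Bbbk$ is an arbitrary field. $R=\Bbbk[x_a: a\in\mathcal{N}]$ is the polynomial ring where the variables are identified by $x_a=x_b$ if and only if $a,b$ are $2$-equivalent, i.e. $a_1+a_2=b_1+b_2$ and $a_3=b_3$ (so variables correspond bijectively to equivalence classes). For $i\in[3]$ and $a,b\in\mathcal{N}$, $\mathrm{sw}(i,a,b)\in\mathcal{N}$ is obtained from $a$ by replacing its $i$-th component by $b_i$; $f_{i,a,b}=x_ax_b-x_{\mathrm{sw}(i,a,b)}x_{\mathrm{sw}(i,b,a)}$; $\mathrm{d}(a,b)=\#\{i\in[3]: a_i\ne b_i\}$. The ideals are $I^{\langle 2,t\rangle}=(f_{i,a,b}: a,b\in\mathcal{N},\ \mathrm{d}(a,b)=2,\ i\in[t])$ and $\widetilde{I}^{\langle 2,t\rangle}=(f_{i,a,b}: a,b\in\mathcal{N},\ i\in[t])$. For a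 subset $\mathcal{S}\subseteq\mathcal{N}$ which is $(2,t)$-switchable (i.e. closed under $2$-equivalence and such that $\mathrm{sw}(i,a,b)\in\mathcal{S}$ for all $a,b\in\mathcal{S}$ with $\mathrm{d}(a,b)=2$ and all $i\in[t]$; the sets $\mathcal{S}^\varphi$ are of this kind), elements $a,b\in\mathcal{S}$ are connected in $\mathcal{S}$ if there are $c_0=a,c_1,\ldots,c_k=b$ in $\mathcal{S}$ with $\mathrm{d}(c_{j-1},c_j)=1$ for all $j\in[k]$, and $P^{\langle 2,t\rangle}_{\mathcal{S}}=(x_a: a\notin\mathcal{S})+(f_{i,a,b}: i\in[t],\ a,b\text{ connected in }\mathcal{S})$. *)

theory Defs
  imports "HOL-Algebra.Ideal" "HOL-Library.Poly_Mapping"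
begin

section \<open>Polynomial rings and minimal primes\<close>

text \<open>A polynomial is a finitely supported map from exponent vectors to coefficients.\<close>

type_synonym ('x, 'k) mpoly = "('x \<Rightarrow>\<^sub>0 nat) \<Rightarrow>\<^sub>0 'k"

text \<open>The type \<open>('x, 'k) mpoly\<close> has all elements of \<open>'x\<close> as variables; the carrier
  restricts the variables to the set \<open>V\<close>.\<close>

definition mpoly_ring :: "'x set \<Rightarrow> ('x, 'k::field) mpoly ring" where
  "mpoly_ring V =
     \<lparr> carrier = {p. \<forall>m \<in> Poly_Mapping.keys p. Poly_Mapping.keys m \<subseteq> V},
       monoid.mult = (*), one = 1, zero = 0, add = (+) \<rparr>"

definition mpoly_var :: "'x \<Rightarrow> ('x, 'k::field) mpoly" where
  "mpoly_var v = Poly_Mapping.single (Poly_Mapping.single v 1) 1"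

definition monomial_ideal :: "'x set \<Rightarrow> ('x, 'k::field) mpoly set \<Rightarrow> bool" where
  "monomial_ideal V J \<longleftrightarrow>
     (\<exists>M. (\<forall>m \<in> M. Poly_Mapping.keys m \<subseteq> V) \<and>
          J = genideal (mpoly_ring V) ((\<lambda>m. Poly_Mapping.single m 1) ` M))"

definition minimal_primes :: "('a, 'b) ring_scheme \<Rightarrow> 'a set \<Rightarrow> 'a set set" where
  "minimal_primes R I =
     {P. primeideal P R \<and> I \<subseteq> P \<and>
         (\<forall>Q. primeideal Q R \<and> I \<subseteq> Q \<and> Q \<subseteq> P \<longrightarrow> Q = P)}"


section \<open>The index set and the ideals\<close>

text \<open>The triple \<open>(r\<^sub>1, r\<^sub>2, r\<^sub>3)\<close> is a function \<open>r\<close> of which only the values at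
  \<open>1, 2, 3\<close> matter. Elements of the index set are functions on \<open>{1..3}\<close>, extended by
  \<open>undefined\<close> elsewhere, so that equality is equality of triples.\<close>

definition idx :: "(nat \<Rightarrow> nat) \<Rightarrow> (nat \<Rightarrow> nat) set" where
  "idx r = (\<Pi>\<^sub>E i \<in> {1..3}. {1..r i})"

definition equiv2 :: "(nat \<Rightarrow> nat) \<Rightarrow> ((nat \<Rightarrow> nat) \<times> (nat \<Rightarrow> nat)) set" where
  "equiv2 r = {(a, b). a \<in> idx r \<and> b \<in> idx r \<and> a 1 + a 2 = b 1 + b 2 \<and> a 3 = b 3}"

definition sw :: "nat \<Rightarrow> (nat \<Rightarrow> nat) \<Rightarrow> (nat \<Rightarrow> nat) \<Rightarrow> (nat \<Rightarrow> nat)" where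
  "sw i a b = a(i := b i)"

definition dst :: "(nat \<Rightarrow> nat) \<Rightarrow> (nat \<Rightarrow> nat) \<Rightarrow> nat" where
  "dst a b = card {i \<in> {1..3}. a i \<noteq> b i}"

text \<open>The variables of the ring are the classes of \<open>equiv2\<close>, which implements the
  identification of \<open>x\<^sub>a\<close> and \<open>x\<^sub>b\<close> for equivalent \<open>a\<close> and \<open>b\<close>.\<close>

abbreviation variables :: "(nat \<Rightarrow> nat) \<Rightarrow> (nat \<Rightarrow> nat) set set" where
  "variables r \<equiv> idx r // equiv2 r"

definition Rng :: "(nat \<Rightarrow> nat) \<Rightarrow> ((nat \<Rightarrow> nat) set, 'k::field) mpoly ring" where
  "Rng r = mpoly_ring (variables r)"

definition xv :: "(nat \<Rightarrow> nat) \<Rightarrow> (nat \<Rightarrow> nat) \<Rightarrow> ((nat \<Rightarrow> nat) set, 'k::field) mpoly" where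
  "xv r a = mpoly_var (equiv2 r `` {a})"

definition fgen ::
    "(nat \<Rightarrow> nat) \<Rightarrow> nat \<Rightarrow> (nat \<Rightarrow> nat) \<Rightarrow> (nat \<Rightarrow> nat) \<Rightarrow> ((nat \<Rightarrow> nat) set, 'k::field) mpoly"
  where
  "fgen r i a b = xv r a * xv r b - xv r (sw i a b) * xv r (sw i b a)"

definition I2 :: "(nat \<Rightarrow> nat) \<Rightarrow> nat \<Rightarrow> ((nat \<Rightarrow> nat) set, 'k::field) mpoly set" where
  "I2 r t = genideal (Rng r)
     {fgen r i a b | i a b. i \<in> {1..t} \<and> a \<in> idx r \<and> b \<in> idx r \<and> dst a b = 2}"

definition I2_tilde :: "(nat \<Rightarrow> nat) \<Rightarrow> nat \<Rightarrow> ((nat \<Rightarrow> nat) set, 'k::field) mpoly set" where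
  "I2_tilde r t = genideal (Rng r)
     {fgen r i a b | i a b. i \<in> {1..t} \<and> a \<in> idx r \<and> b \<in> idx r}"

definition connected_in :: "(nat \<Rightarrow> nat) set \<Rightarrow> (nat \<Rightarrow> nat) \<Rightarrow> (nat \<Rightarrow> nat) \<Rightarrow> bool" where
  "connected_in S a b \<longleftrightarrow>
     a \<in> S \<and> b \<in> S \<and> (a, b) \<in> {(c, c'). c \<in> S \<and> c' \<in> S \<and> dst c c' = 1}\<^sup>*"

definition P2 ::
    "(nat \<Rightarrow> nat) \<Rightarrow> nat \<Rightarrow> (nat \<Rightarrow> nat) set \<Rightarrow> ((nat \<Rightarrow> nat) set, 'k::field) mpoly set"
  where
  "P2 r t S =
     genideal (Rng r) {xv r a | a. a \<in> idx r - S}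
     <+>\<^bsub>Rng r\<^esub>
     genideal (Rng r) {fgen r i a b | i a b. i \<in> {1..t} \<and> connected_in S a b}"

definition S_phi :: "(nat \<Rightarrow> nat) \<Rightarrow> (nat \<Rightarrow> nat \<times> nat) \<Rightarrow> (nat \<Rightarrow> nat) set" where
  "S_phi r \<phi> = {a \<in> idx r. (a 1, a 2) = \<phi> (a 3)}"

definition nonconst_phis :: "(nat \<Rightarrow> nat) \<Rightarrow> (nat \<Rightarrow> nat \<times> nat) set" where
  "nonconst_phis r =
     {\<phi> \<in> {1..r 3} \<rightarrow>\<^sub>E {(1, 1), (r 1, r 2)}. \<exists>c \<in> {1..r 3}. \<exists>c' \<in> {1..r 3}. \<phi> c \<noteq> \<phi> c'}"

end

theory Submission
  imports Defs "HOL-Library.Multiset"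
begin

text \<open>
  The class of \<open>a\<close> depends only on \<open>k = a 1 + a 2 - 2\<close> and the row \<open>c = a 3\<close>, so the variables form a
  grid \<open>y k c\<close> with \<open>0 \<le> k \<le> deg = r 1 + r 2 - 2\<close>. In these coordinates every generator is a binomial
  \<open>y k c * y l e - y k' c * y l' e\<close> with \<open>k + l = k' + l'\<close>.

  The ideal \<open>I2_tilde\<close> contains all unit exchanges \<open>y k c * y (k' + 1) e - y (k + 1) c * y k' e\<close>
  (\<open>exchange_of_switches\<close>), and unit exchanges alone connect any two monomials with the same rows
  and the same total weight \<open>\<Sum>k\<close> (\<open>exchange_monomials\<close>). Hence \<open>I2_tilde\<close> is the kernel of the
  monomial map \<open>y k c \<mapsto> u\<^sup>k z\<^sub>c\<close> and is prime (\<open>I2_tilde_eq_kernel\<close>); geometrically it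
  defines a rational normal scroll. The ideal attached to \<open>\<phi>\<close> is generated by variables: in each row the
  only variable it leaves out is one of the corners \<open>y 0 c\<close> and \<open>y deg c\<close>. It is the kernel of the map that sends
  the surviving variable of row \<open>c\<close> to \<open>z\<^sub>c\<close> (\<open>P2_eq_kernel\<close>).

  Now let \<open>P\<close> be a prime above \<open>I2\<close>, and read membership in \<open>P\<close> as vanishing. The relations inside one row
  say that the row is a geometric progression: if both ends are nonzero then no entry vanishes
  (\<open>row_full\<close>), and otherwise every entry but the opposite end vanishes (\<open>row_high\<close>, \<open>row_low\<close>). If some
  row has no zero, the adjacent minors
  force every other row to be a multiple of the same progression, so all exchanges hold and \<open>P\<close>
  contains \<open>I2_tilde\<close>. Otherwise all rows are supported on corners. If they are all supported on the same
  side, all exchanges hold trivially; if not, choosing in each row a side that supports it yields a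
  nonconstant \<open>\<phi>\<close> with \<open>P2 r t (S_phi r \<phi>) \<subseteq> P\<close> (\<open>prime_above_I2\<close>).

  So every prime above \<open>I2\<close> contains one of the listed primes. That they are pairwise incomparable
  is seen by evaluating a variable or one exchange under the defining maps, and counting the
  \<open>\<phi>\<close> gives \<open>1 + (2 ^ r 3 - 2)\<close>.
\<close>

section \<open>Polynomial rings on a set of variables\<close>

lemma mpoly_ring_simps [simp]:
  "monoid.mult (mpoly_ring V) = (*)" "one (mpoly_ring V) = 1"
  "zero (mpoly_ring V) = 0" "add (mpoly_ring V) = (+)"
  by (simp_all add: mpoly_ring_def)

lemma mem_carrier_mpoly_ring:
  "p \<in> carrier (mpoly_ring V) \<longleftrightarrow> (\<forall>m \<in> Poly_Mapping.keys p. Poly_Mapping.keys m \<subseteq> V)"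
  by (simp add: mpoly_ring_def)

lemma carrier_mpoly_ring_closed [intro, simp]:
  shows "0 \<in> carrier (mpoly_ring V)" and "1 \<in> carrier (mpoly_ring V)"
    and "p \<in> carrier (mpoly_ring V) \<Longrightarrow> q \<in> carrier (mpoly_ring V) \<Longrightarrow> p + q \<in> carrier (mpoly_ring V)"
    and "p \<in> carrier (mpoly_ring V) \<Longrightarrow> - p \<in> carrier (mpoly_ring V)"
    and "p \<in> carrier (mpoly_ring V) \<Longrightarrow> q \<in> carrier (mpoly_ring V) \<Longrightarrow> p - q \<in> carrier (mpoly_ring V)"
    and "p \<in> carrier (mpoly_ring V) \<Longrightarrow> q \<in> carrier (mpoly_ring V) \<Longrightarrow> p * q \<in> carrier (mpoly_ring V)"
proof -
  show "0 \<in> carrier (mpoly_ring V)" "1 \<in> carrier (mpoly_ring V)"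
    by (simp_all add: mem_carrier_mpoly_ring)
  show add: "p + q \<in> carrier (mpoly_ring V)"
    if "p \<in> carrier (mpoly_ring V)" "q \<in> carrier (mpoly_ring V)" for p q
    using that Poly_Mapping.keys_add[of p q] unfolding mem_carrier_mpoly_ring by blast
  show neg: "- p \<in> carrier (mpoly_ring V)" if "p \<in> carrier (mpoly_ring V)" for p
    using that by (simp add: mem_carrier_mpoly_ring in_keys_iff)
  show "p - q \<in> carrier (mpoly_ring V)"
    if "p \<in> carrier (mpoly_ring V)" "q \<in> carrier (mpoly_ring V)" for p q
    using add[OF that(1) neg[OF that(2)]] by simp
  show "p * q \<in> carrier (mpoly_ring V)"
    if p: "p \<in> carrier (mpoly_ring V)" and q: "q \<in> carrier (mpoly_ring V)" for p q
    unfolding mem_carrier_mpoly_ring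
  proof
    fix m assume "m \<in> Poly_Mapping.keys (p * q)"
    then obtain a b where "a \<in> Poly_Mapping.keys p" "b \<in> Poly_Mapping.keys q" "m = a + b"
      using keys_mult[of p q] by blast
    then show "Poly_Mapping.keys m \<subseteq> V"
      using p q Poly_Mapping.keys_add[of a b] unfolding mem_carrier_mpoly_ring by blast
  qed
qed

lemma monomial_in_carrier [intro]:
  "Poly_Mapping.keys m \<subseteq> V \<Longrightarrow> Poly_Mapping.single m c \<in> carrier (mpoly_ring V)"
  by (simp add: mem_carrier_mpoly_ring)

lemma mpoly_var_in_carrier [intro]:
  "v \<in> V \<Longrightarrow> mpoly_var v \<in> carrier (mpoly_ring V)"
  by (simp add: mpoly_var_def mem_carrier_mpoly_ring)

lemma cring_mpoly_ring: "cring (mpoly_ring V)"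
proof (rule cringI)
  show "abelian_group (mpoly_ring V)"
  proof (rule abelian_groupI)
    fix x assume "x \<in> carrier (mpoly_ring V)"
    then show "\<exists>y\<in>carrier (mpoly_ring V). y \<oplus>\<^bsub>mpoly_ring V\<^esub> x = \<zero>\<^bsub>mpoly_ring V\<^esub>"
      by (intro bexI[of _ "- x"]) auto
  qed (auto simp: algebra_simps)
  show "comm_monoid (mpoly_ring V)"
    by (rule comm_monoidI) (auto simp: algebra_simps)
qed (auto simp: algebra_simps)

lemma ring_mpoly_ring: "ring (mpoly_ring V)"
  using cring_mpoly_ring by (rule cring.axioms)

lemma a_inv_mpoly_ring:
  assumes "p \<in> carrier (mpoly_ring V)"
  shows "\<ominus>\<^bsub>mpoly_ring V\<^esub> p = - p"
proof -
  interpret ring "mpoly_ring V" by (rule ring_mpoly_ring)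
  show ?thesis
    using minus_equality[of "- p" p] assms by simp
qed

text \<open>The ring operations of \<open>mpoly_ring V\<close> are those of the type, so ideal membership can be
  handled with type-class arithmetic; the differences below play the role of congruences.\<close>

context
  fixes V :: "'x set" and J :: "('x, 'k::field) mpoly set"
  assumes J: "ideal J (mpoly_ring V)"
begin

interpretation ideal J "mpoly_ring V" by (rule J)

lemma ideal_subset: "p \<in> J \<Longrightarrow> p \<in> carrier (mpoly_ring V)"
  using Icarr .

lemma ideal_zero: "0 \<in> J"
  using additive_subgroup.zero_closed[OF is_additive_subgroup] by simp

lemma ideal_add: "p \<in> J \<Longrightarrow> q \<in> J \<Longrightarrow> p + q \<in> J"
  using additive_subgroup.a_closed[OF is_additive_subgroup] by simp

lemma ideal_uminus: "p \<in> J \<Longrightarrow> - p \<in> J"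
  using a_inv_closed[of p] a_inv_mpoly_ring[of p V] ideal_subset
    additive_subgroup.a_inv_closed[OF is_additive_subgroup] by metis

lemma ideal_diff: "p \<in> J \<Longrightarrow> q \<in> J \<Longrightarrow> p - q \<in> J"
  using ideal_add[of p "- q"] ideal_uminus by simp

lemma ideal_mult: "p \<in> J \<Longrightarrow> q \<in> carrier (mpoly_ring V) \<Longrightarrow> q * p \<in> J"
  using I_l_closed by simp

lemma ideal_diff_commute: "p - q \<in> J \<Longrightarrow> q - p \<in> J"
  using ideal_uminus by fastforce

lemma ideal_diff_trans: "p - q \<in> J \<Longrightarrow> q - s \<in> J \<Longrightarrow> p - s \<in> J"
  using ideal_add[of "p - q" "q - s"] by simp

lemma ideal_diff_mult:
  "p - q \<in> J \<Longrightarrow> s \<in> carrier (mpoly_ring V) \<Longrightarrow> s * p - s * q \<in> J"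
  using ideal_mult[of "p - q" s] by (simp add: algebra_simps)

end

lemma idealI_mpoly:
  assumes "J \<subseteq> carrier (mpoly_ring V)" "0 \<in> J"
    and "\<And>p q. p \<in> J \<Longrightarrow> q \<in> J \<Longrightarrow> p + q \<in> J"
    and "\<And>p q. p \<in> J \<Longrightarrow> q \<in> carrier (mpoly_ring V) \<Longrightarrow> q * p \<in> J"
  shows "ideal J (mpoly_ring V)"
proof (rule idealI)
  show "ring (mpoly_ring V)" by (rule ring_mpoly_ring)
  interpret ring "mpoly_ring V" by (rule ring_mpoly_ring)
  show "subgroup J (add_monoid (mpoly_ring V))"
  proof (rule add.subgroupI)
    fix p assume p: "p \<in> J"
    have "(- 1) * p \<in> J"
      by (rule assms(4)[OF p]) (intro carrier_mpoly_ring_closed)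
    then show "\<ominus>\<^bsub>mpoly_ring V\<^esub> p \<in> J"
      using a_inv_mpoly_ring[of p V] p assms(1) by auto
  qed (use assms in auto)
  show "x \<otimes>\<^bsub>mpoly_ring V\<^esub> a \<in> J" "a \<otimes>\<^bsub>mpoly_ring V\<^esub> x \<in> J"
    if "a \<in> J" "x \<in> carrier (mpoly_ring V)" for a x
    using assms(4)[OF that] by (simp_all add: mult.commute)
qed

section \<open>Evaluation homomorphisms\<close>

definition monom_eval :: "('x \<Rightarrow> 'a::comm_monoid_mult) \<Rightarrow> ('x \<Rightarrow>\<^sub>0 nat) \<Rightarrow> 'a" where
  "monom_eval h m = (\<Prod>v \<in> Poly_Mapping.keys m. h v ^ Poly_Mapping.lookup m v)"

lemma monom_eval_superset:
  assumes "finite A" "Poly_Mapping.keys m \<subseteq> A"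
  shows "monom_eval h m = (\<Prod>v \<in> A. h v ^ Poly_Mapping.lookup m v)"
  unfolding monom_eval_def
  by (rule prod.mono_neutral_left) (use assms in \<open>auto simp: in_keys_iff\<close>)

lemma monom_eval_add: "monom_eval h (m + n) = monom_eval h m * monom_eval h n"
proof -
  let ?A = "Poly_Mapping.keys m \<union> Poly_Mapping.keys n"
  have "monom_eval h (m + n) = (\<Prod>v \<in> ?A. h v ^ Poly_Mapping.lookup (m + n) v)"
    by (rule monom_eval_superset) (simp_all add: Poly_Mapping.keys_add)
  then show ?thesis
    by (simp add: monom_eval_superset[of ?A] lookup_add power_add prod.distrib)
qed

lemma monom_eval_zero [simp]: "monom_eval h 0 = 1"
  by (simp add: monom_eval_def)

lemma monom_eval_var [simp]: "monom_eval h (Poly_Mapping.single v (Suc 0)) = h v"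
  by (simp add: monom_eval_def)

text \<open>The target is again a polynomial ring over the same field, on exponents of another type: for
  exponents \<open>nat \<Rightarrow>\<^sub>0 nat\<close>, unlike for exponents on classes, it is an instance of \<open>idom\<close>.\<close>

definition mpoly_eval ::
    "('x \<Rightarrow> ('b::comm_monoid_add \<Rightarrow>\<^sub>0 'k::field)) \<Rightarrow> ('x, 'k) mpoly \<Rightarrow> ('b \<Rightarrow>\<^sub>0 'k)" where
  "mpoly_eval h p =
     (\<Sum>m \<in> Poly_Mapping.keys p. Poly_Mapping.single 0 (Poly_Mapping.lookup p m) * monom_eval h m)"

lemma mpoly_eval_superset:
  assumes "finite A" "Poly_Mapping.keys p \<subseteq> A"
  shows "mpoly_eval h p =
    (\<Sum>m \<in> A. Poly_Mapping.single 0 (Poly_Mapping.lookup p m) * monom_eval h m)"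
  unfolding mpoly_eval_def
  by (rule sum.mono_neutral_left) (use assms in \<open>auto simp: in_keys_iff\<close>)

lemma mpoly_eval_add: "mpoly_eval h (p + q) = mpoly_eval h p + mpoly_eval h q"
proof -
  let ?A = "Poly_Mapping.keys p \<union> Poly_Mapping.keys q"
  have "mpoly_eval h (p + q) =
      (\<Sum>m \<in> ?A. Poly_Mapping.single 0 (Poly_Mapping.lookup (p + q) m) * monom_eval h m)"
    by (rule mpoly_eval_superset) (simp_all add: Poly_Mapping.keys_add)
  then show ?thesis
    by (simp add: mpoly_eval_superset[of ?A] lookup_add single_add sum.distrib algebra_simps)
qed

lemma mpoly_eval_zero [simp]: "mpoly_eval h 0 = 0"
  by (simp add: mpoly_eval_def)

lemma mpoly_eval_uminus: "mpoly_eval h (- p) = - mpoly_eval h p"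
  using mpoly_eval_add[of h p "- p"] by (simp add: add_eq_0_iff)

lemma mpoly_eval_diff: "mpoly_eval h (p - q) = mpoly_eval h p - mpoly_eval h q"
  using mpoly_eval_add[of h p "- q"] by (simp add: mpoly_eval_uminus)

lemma mpoly_eval_monomial:
  "mpoly_eval h (Poly_Mapping.single m c) = Poly_Mapping.single 0 c * monom_eval h m"
  by (cases "c = 0") (simp_all add: mpoly_eval_def)

lemma mpoly_eval_one [simp]: "mpoly_eval h 1 = 1"
  using mpoly_eval_monomial[of h 0 1] by simp

lemma mpoly_eval_var [simp]: "mpoly_eval h (mpoly_var v) = h v"
  by (simp add: mpoly_var_def mpoly_eval_monomial)

lemma mpoly_eval_sum: "mpoly_eval h (sum f A) = (\<Sum>i\<in>A. mpoly_eval h (f i))"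
  by (induction A rule: infinite_finite_induct) (simp_all add: mpoly_eval_add)

lemma mpoly_eq_sum_monomials:
  "p = (\<Sum>m \<in> Poly_Mapping.keys p. Poly_Mapping.single m (Poly_Mapping.lookup p m))"
  by (rule poly_mapping_eqI) (auto simp: lookup_sum lookup_single when_def in_keys_iff)

lemma mpoly_eval_mult: "mpoly_eval h (p * q) = mpoly_eval h p * mpoly_eval h q"
proof -
  let ?s = "\<lambda>p m. Poly_Mapping.single m (Poly_Mapping.lookup p m)"
  have "p * q = (\<Sum>m \<in> Poly_Mapping.keys p. ?s p m) * (\<Sum>n \<in> Poly_Mapping.keys q. ?s q n)"
    using mpoly_eq_sum_monomials[of p] mpoly_eq_sum_monomials[of q] by simp
  also have "\<dots> = (\<Sum>m \<in> Poly_Mapping.keys p. \<Sum>n \<in> Poly_Mapping.keys q. ?s p m * ?s q n)"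
    by (rule sum_product)
  finally have "mpoly_eval h (p * q) =
      (\<Sum>m \<in> Poly_Mapping.keys p. \<Sum>n \<in> Poly_Mapping.keys q. mpoly_eval h (?s p m * ?s q n))"
    by (simp only: mpoly_eval_sum)
  also have "\<dots> = (\<Sum>m \<in> Poly_Mapping.keys p. \<Sum>n \<in> Poly_Mapping.keys q.
      (Poly_Mapping.single 0 (Poly_Mapping.lookup p m) * monom_eval h m) *
      (Poly_Mapping.single 0 (Poly_Mapping.lookup q n) * monom_eval h n))"
  proof (intro sum.cong refl)
    fix m n
    have "mpoly_eval h (?s p m * ?s q n) =
        Poly_Mapping.single (0 + 0) (Poly_Mapping.lookup p m * Poly_Mapping.lookup q n)
          * (monom_eval h m * monom_eval h n)"
      by (simp add: mult_single mpoly_eval_monomial monom_eval_add)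
    then show "mpoly_eval h (?s p m * ?s q n) =
        (Poly_Mapping.single 0 (Poly_Mapping.lookup p m) * monom_eval h m) *
        (Poly_Mapping.single 0 (Poly_Mapping.lookup q n) * monom_eval h n)"
      by (simp only: mult_single[symmetric] ac_simps)
  qed
  also have "\<dots> = mpoly_eval h p * mpoly_eval h q"
    by (simp add: mpoly_eval_def sum_product)
  finally show ?thesis .
qed

text \<open>The linear order on the exponents makes the target a domain.\<close>

lemma primeideal_eval_kernel:
  fixes h :: "'x \<Rightarrow> ('b::{ordered_cancel_comm_monoid_add, linorder} \<Rightarrow>\<^sub>0 'k::field)"
  shows "primeideal {p \<in> carrier (mpoly_ring V). mpoly_eval h p = 0} (mpoly_ring V)"
proof (rule primeidealI)
  show "ideal {p \<in> carrier (mpoly_ring V). mpoly_eval h p = 0} (mpoly_ring V)"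
    by (rule idealI_mpoly) (auto simp: mpoly_eval_add mpoly_eval_mult)
  show "cring (mpoly_ring V)" by (rule cring_mpoly_ring)
  have "1 \<in> carrier (mpoly_ring V)" by (rule carrier_mpoly_ring_closed)
  moreover have "1 \<notin> {p \<in> carrier (mpoly_ring V). mpoly_eval h p = 0}" by simp
  ultimately show "carrier (mpoly_ring V) \<noteq> {p \<in> carrier (mpoly_ring V). mpoly_eval h p = 0}"
    by blast
qed (auto simp: mpoly_eval_mult)

text \<open>A polynomial in the kernel of a monomial map has, next to each monomial that survives, a
  second one with the same image, because their coefficients add up to zero. So subtracting a
  multiple of a monomial or of a binomial from the ideal shortens the polynomial.\<close>

lemma monomial_map_kernel_subset:
  fixes h :: "'x \<Rightarrow> ('b::comm_monoid_add \<Rightarrow>\<^sub>0 'k::field)"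
  assumes J: "ideal J (mpoly_ring V)"
    and img: "\<And>m. Poly_Mapping.keys m \<subseteq> V \<Longrightarrow>
      monom_eval h m = 0 \<and> Poly_Mapping.single m 1 \<in> J \<or>
      (\<exists>w. monom_eval h m = Poly_Mapping.single w 1)"
    and eq: "\<And>m n. Poly_Mapping.keys m \<subseteq> V \<Longrightarrow> Poly_Mapping.keys n \<subseteq> V \<Longrightarrow>
      monom_eval h m = monom_eval h n \<Longrightarrow> monom_eval h m \<noteq> 0 \<Longrightarrow>
      Poly_Mapping.single m 1 - Poly_Mapping.single n 1 \<in> J"
    and p: "p \<in> carrier (mpoly_ring V)" "mpoly_eval h p = 0"
    and J0: "\<And>p. p \<in> J \<Longrightarrow> mpoly_eval h p = 0"
  shows "p \<in> J"
  using p
proof (induction "card (Poly_Mapping.keys p)" arbitrary: p rule: less_induct)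
  case less
  show ?case
  proof (cases "p = 0")
    case True
    then show ?thesis using ideal_zero[OF J] by simp
  next
    case False
    then obtain m where m: "m \<in> Poly_Mapping.keys p"
      by (metis ex_in_conv keys_zero poly_mapping_eqI lookup_zero in_keys_iff)
    define c where "c = Poly_Mapping.lookup p m"
    have mV: "Poly_Mapping.keys m \<subseteq> V" and c: "c \<noteq> 0"
      using m less.prems(1) by (auto simp: mem_carrier_mpoly_ring c_def in_keys_iff)
    have const: "Poly_Mapping.single 0 c \<in> carrier (mpoly_ring V)"
      by (rule monomial_in_carrier) simp
    have step: "p \<in> J" if q: "q \<in> J"
      and sub: "Poly_Mapping.keys (p - Poly_Mapping.single 0 c * q) \<subset> Poly_Mapping.keys p" for q
    proof -
      have cq: "Poly_Mapping.single 0 c * q \<in> J"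
        using ideal_mult[OF J q const] .
      have "p - Poly_Mapping.single 0 c * q \<in> J"
      proof (rule less.hyps)
        show "card (Poly_Mapping.keys (p - Poly_Mapping.single 0 c * q)) < card (Poly_Mapping.keys p)"
          using sub by (intro psubset_card_mono) auto
        show "p - Poly_Mapping.single 0 c * q \<in> carrier (mpoly_ring V)"
          using less.prems(1) ideal_subset[OF J cq] by auto
        show "mpoly_eval h (p - Poly_Mapping.single 0 c * q) = 0"
          using less.prems(2) J0[OF cq] by (simp add: mpoly_eval_diff)
      qed
      then show ?thesis using ideal_add[OF J _ cq] by fastforce
    qed
    from img[OF mV] show ?thesis
    proof (elim disjE conjE exE)
      assume "Poly_Mapping.single m 1 \<in> J"
      then show ?thesis
      proof (rule step)
        have "m \<notin> Poly_Mapping.keys (p - Poly_Mapping.single 0 c * Poly_Mapping.single m 1)"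
          by (simp add: in_keys_iff lookup_minus mult_single c_def)
        moreover have "Poly_Mapping.keys (p - Poly_Mapping.single 0 c * Poly_Mapping.single m 1)
            \<subseteq> Poly_Mapping.keys p"
          using m by (auto simp: in_keys_iff lookup_minus mult_single lookup_single when_def
              split: if_splits)
        ultimately show "Poly_Mapping.keys (p - Poly_Mapping.single 0 c * Poly_Mapping.single m 1)
            \<subset> Poly_Mapping.keys p"
          using m by blast
      qed
    next
      fix w assume w: "monom_eval h m = Poly_Mapping.single w 1"
      let ?g = "\<lambda>n. Poly_Mapping.lookup p n * Poly_Mapping.lookup (monom_eval h n) w"
      have const_mult: "Poly_Mapping.lookup (Poly_Mapping.single 0 a * q) w =
          a * Poly_Mapping.lookup q w" for a :: 'k and q :: "'b \<Rightarrow>\<^sub>0 'k"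
        by (simp add: mult_map_scale_conv_mult[symmetric] Poly_Mapping.map.rep_eq when_def)
      have "(\<Sum>n \<in> Poly_Mapping.keys p. ?g n) = Poly_Mapping.lookup (mpoly_eval h p) w"
        by (simp add: mpoly_eval_def lookup_sum const_mult)
      then have "(\<Sum>n \<in> Poly_Mapping.keys p. ?g n) = 0"
        using less.prems by simp
      moreover have "?g m \<noteq> 0"
        using w c by (simp add: c_def)
      ultimately obtain n where n: "n \<in> Poly_Mapping.keys p" "n \<noteq> m" "?g n \<noteq> 0"
        using m sum.remove[OF finite_keys m, of ?g]
        by (metis (no_types, lifting) DiffE add.right_neutral insertCI sum.neutral)
      have nV: "Poly_Mapping.keys n \<subseteq> V"
        using n less.prems(1) by (auto simp: mem_carrier_mpoly_ring)
      obtain w' where w': "monom_eval h n = Poly_Mapping.single w' 1"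
        using img[OF nV] n(3) by auto
      with n(3) have "w' = w"
        by (auto simp: lookup_single when_def split: if_splits)
      then have "Poly_Mapping.single m 1 - Poly_Mapping.single n 1 \<in> J"
        using w w' by (intro eq[OF mV nV]) (auto simp: poly_mapping_eq_iff fun_eq_iff lookup_single when_def)
      then show ?thesis
      proof (rule step)
        let ?q = "p - Poly_Mapping.single 0 c * (Poly_Mapping.single m 1 - Poly_Mapping.single n 1)"
        have q: "?q = p - Poly_Mapping.single m c + Poly_Mapping.single n c"
          by (simp add: right_diff_distrib mult_single)
        have "m \<notin> Poly_Mapping.keys ?q"
          unfolding q using n(2) by (simp add: in_keys_iff lookup_minus lookup_add c_def lookup_single)
        moreover have "Poly_Mapping.keys ?q \<subseteq> Poly_Mapping.keys p"
          unfolding q using m n(1)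
          by (auto simp: in_keys_iff lookup_minus lookup_add lookup_single when_def split: if_splits)
        ultimately show "Poly_Mapping.keys ?q \<subset> Poly_Mapping.keys p"
          using m by blast
      qed
    qed
  qed
qed

lemma monomial_eq_prod_vars:
  "\<exists>M. set_mset M = Poly_Mapping.keys m \<and>
     Poly_Mapping.single m 1 = (\<Prod>v\<in>#M. mpoly_var v :: ('x, 'k::field) mpoly)"
proof (induction "\<Sum>v\<in>Poly_Mapping.keys m. Poly_Mapping.lookup m v" arbitrary: m rule: less_induct)
  case less
  show ?case
  proof (cases "m = 0")
    case True
    then show ?thesis by (intro exI[of _ "{#}"]) simp
  next
    case False
    then obtain v where v: "v \<in> Poly_Mapping.keys m"
      by (metis ex_in_conv keys_zero poly_mapping_eqI lookup_zero in_keys_iff)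
    let ?s = "Poly_Mapping.single v (1::nat)"
    define n where "n = m - ?s"
    have m: "m = n + ?s"
      using v by (intro poly_mapping_eqI)
        (auto simp: n_def lookup_add lookup_minus lookup_single when_def in_keys_iff)
    have keys: "Poly_Mapping.keys m = insert v (Poly_Mapping.keys n)"
      by (auto simp: m in_keys_iff lookup_add lookup_single when_def split: if_splits)
    have "(\<Sum>u\<in>Poly_Mapping.keys n. Poly_Mapping.lookup n u)
        = (\<Sum>u\<in>Poly_Mapping.keys m. Poly_Mapping.lookup n u)"
      by (rule sum.mono_neutral_left) (auto simp: keys in_keys_iff)
    also have "\<dots> < (\<Sum>u\<in>Poly_Mapping.keys m. Poly_Mapping.lookup m u)"
    proof (rule sum_strict_mono_ex1)
      show "\<exists>u\<in>Poly_Mapping.keys m. Poly_Mapping.lookup n u < Poly_Mapping.lookup m u"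
        by (rule bexI[OF _ v]) (simp add: m lookup_add)
    qed (simp_all add: m lookup_add)
    finally obtain M where M: "set_mset M = Poly_Mapping.keys n"
        "Poly_Mapping.single n 1 = (\<Prod>v\<in>#M. mpoly_var v :: ('x, 'k) mpoly)"
      using less by blast
    have "Poly_Mapping.single m 1 = (mpoly_var v * Poly_Mapping.single n 1 :: ('x, 'k) mpoly)"
      by (simp add: m mpoly_var_def mult_single add.commute)
    then show ?thesis
      by (intro exI[of _ "add_mset v M"]) (simp add: M keys)
  qed
qed

lemma prod_vars_in_carrier:
  "set_mset M \<subseteq> V \<Longrightarrow> (\<Prod>v\<in>#M. mpoly_var v) \<in> carrier (mpoly_ring V)"
  by (induction M) auto

lemma mpoly_eval_prod_mset: "mpoly_eval h (\<Prod>v\<in>#M. f v) = (\<Prod>v\<in>#M. mpoly_eval h (f v))"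
  by (induction M) (simp_all add: mpoly_eval_mult)

lemma prod_mset_single:
  "(\<Prod>v\<in>#M. Poly_Mapping.single (e v) (1::'k::field)) = Poly_Mapping.single (\<Sum>v\<in>#M. e v) 1"
  by (induction M) (simp_all add: mult_single)

text \<open>For a map that kills the variables in \<open>W\<close> and sends the others to monomials, it is enough to test
  products of surviving variables. Products are indexed by multisets, which is the form in which the
  exchange arguments work.\<close>

lemma monomial_map_kernel:
  fixes e :: "'x \<Rightarrow> 'b::comm_monoid_add" and J :: "('x, 'k::field) mpoly set" and W :: "'x set"
  defines "h \<equiv> \<lambda>v. if v \<in> W then 0 else Poly_Mapping.single (e v) 1"
  assumes J: "ideal J (mpoly_ring V)" and J0: "\<And>p. p \<in> J \<Longrightarrow> mpoly_eval h p = 0"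
    and W: "\<And>v. v \<in> V \<Longrightarrow> v \<in> W \<Longrightarrow> mpoly_var v \<in> J"
    and eq: "\<And>M N. set_mset M \<subseteq> V - W \<Longrightarrow> set_mset N \<subseteq> V - W \<Longrightarrow>
      (\<Sum>v\<in>#M. e v) = (\<Sum>v\<in>#N. e v) \<Longrightarrow>
      (\<Prod>v\<in>#M. mpoly_var v) - (\<Prod>v\<in>#N. mpoly_var v) \<in> J"
  shows "J = {p \<in> carrier (mpoly_ring V). mpoly_eval h p = 0}"
proof
  show "J \<subseteq> {p \<in> carrier (mpoly_ring V). mpoly_eval h p = 0}"
    using ideal_subset[OF J] J0 by blast
  have eval: "monom_eval h m = (if set_mset M \<subseteq> - W then Poly_Mapping.single (\<Sum>v\<in>#M. e v) 1 else 0)"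
    if "Poly_Mapping.single m 1 = (\<Prod>v\<in>#M. mpoly_var v :: ('x, 'k) mpoly)" for m M
  proof -
    have "monom_eval h m = mpoly_eval h (Poly_Mapping.single m 1)"
      by (simp add: mpoly_eval_monomial)
    also have "\<dots> = (\<Prod>v\<in>#M. h v)"
      by (simp add: that mpoly_eval_prod_mset)
    also have "\<dots> = (if set_mset M \<subseteq> - W then Poly_Mapping.single (\<Sum>v\<in>#M. e v) 1 else 0)"
    proof (cases "set_mset M \<subseteq> - W")
      case True
      then have "(\<Prod>v\<in>#M. h v) = (\<Prod>v\<in>#M. Poly_Mapping.single (e v) 1)"
        by (intro arg_cong[of _ _ prod_mset] image_mset_cong) (auto simp: h_def)
      then show ?thesis using True by (simp add: prod_mset_single)
    next
      case False
      then obtain v where v: "v \<in># M" "v \<in> W" by auto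
      then have "h v = 0" by (simp add: h_def)
      moreover obtain N where "M = add_mset v N" using v by (metis mset_add)
      ultimately have "(\<Prod>v\<in>#M. h v) = 0" by simp
      then show ?thesis using False by simp
    qed
    finally show ?thesis .
  qed
  show "{p \<in> carrier (mpoly_ring V). mpoly_eval h p = 0} \<subseteq> J"
  proof (safe, rule monomial_map_kernel_subset[OF J, where h = h])
    fix m :: "'x \<Rightarrow>\<^sub>0 nat" assume mV: "Poly_Mapping.keys m \<subseteq> V"
    obtain M where M: "set_mset M = Poly_Mapping.keys m"
        "Poly_Mapping.single m 1 = (\<Prod>v\<in>#M. mpoly_var v :: ('x, 'k) mpoly)"
      using monomial_eq_prod_vars[of m, where 'k = 'k] by meson
    show "monom_eval h m = 0 \<and> Poly_Mapping.single m 1 \<in> J \<or>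
      (\<exists>w. monom_eval h m = Poly_Mapping.single w 1)"
    proof (cases "set_mset M \<subseteq> - W")
      case False
      then obtain v where v: "v \<in># M" "v \<in> W" by auto
      then obtain N where N: "M = add_mset v N" by (metis mset_add)
      have "(\<Prod>v\<in>#N. mpoly_var v) * mpoly_var v \<in> J"
        by (intro ideal_mult[OF J] W prod_vars_in_carrier) (use v N M mV in auto)
      then show ?thesis
        using eval[OF M(2)] v(2) by (simp add: M(2) N mult.commute)
    qed (use eval[OF M(2)] in auto)
    fix n :: "'x \<Rightarrow>\<^sub>0 nat" assume nV: "Poly_Mapping.keys n \<subseteq> V"
    obtain N where N: "set_mset N = Poly_Mapping.keys n"
        "Poly_Mapping.single n 1 = (\<Prod>v\<in>#N. mpoly_var v :: ('x, 'k) mpoly)"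
      using monomial_eq_prod_vars[of n, where 'k = 'k] by meson
    assume mn: "monom_eval h m = monom_eval h n" "monom_eval h m \<noteq> 0"
    then have sub: "set_mset M \<subseteq> - W" "set_mset N \<subseteq> - W"
      using eval[OF M(2)] eval[OF N(2)] by (auto split: if_splits)
    then have "Poly_Mapping.single (\<Sum>v\<in>#M. e v) (1::'k) = Poly_Mapping.single (\<Sum>v\<in>#N. e v) 1"
      using mn eval[OF M(2)] eval[OF N(2)] by simp
    then have "(\<Sum>v\<in>#M. e v) = (\<Sum>v\<in>#N. e v)"
      by (metis lookup_single_eq lookup_single_not_eq zero_neq_one)
    then show "Poly_Mapping.single m 1 - Poly_Mapping.single n 1 \<in> J"
      unfolding M(2) N(2) using sub mV nV M(1) N(1) by (intro eq) auto
  qed (use J0 in auto)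
qed

section \<open>Grid coordinates for the variables\<close>

locale box =
  fixes r :: "nat \<Rightarrow> nat"
  assumes r1: "2 \<le> r 1" and r2: "2 \<le> r 2" and r3: "2 \<le> r 3"
begin

definition deg :: nat where
  "deg = r 1 + r 2 - 2"

definition triple :: "nat \<Rightarrow> nat \<Rightarrow> nat \<Rightarrow> nat \<Rightarrow> nat" where
  "triple p q c = (\<lambda>_. undefined)(1 := p, 2 := q, 3 := c)"

lemma triple_simps [simp]:
  "triple p q c 1 = p" "triple p q c (Suc 0) = p" "triple p q c 2 = q" "triple p q c 3 = c"
  by (simp_all add: triple_def)

lemma three: "{1..3::nat} = {1, 2, 3}"
  by auto

lemma triple_in_idx [simp]:
  "triple p q c \<in> idx r \<longleftrightarrow> p \<in> {1..r 1} \<and> q \<in> {1..r 2} \<and> c \<in> {1..r 3}"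
  unfolding idx_def three by (auto simp: PiE_iff triple_def extensional_def)

lemma idx_bounds:
  assumes "a \<in> idx r"
  shows "1 \<le> a 1" "a 1 \<le> r 1" "1 \<le> a 2" "a 2 \<le> r 2" "1 \<le> a 3" "a 3 \<le> r 3"
  using assms unfolding idx_def three by (auto simp: PiE_iff)

lemma idx_triple:
  assumes "a \<in> idx r"
  shows "a = triple (a 1) (a 2) (a 3)"
proof
  fix i show "a i = triple (a 1) (a 2) (a 3) i"
    using assms unfolding idx_def three
    by (cases "i \<in> {1, 2, 3}") (auto simp: PiE_iff extensional_def triple_def)
qed

lemma idxE:
  assumes "a \<in> idx r"
  obtains p q c where "a = triple p q c" "p \<in> {1..r 1}" "q \<in> {1..r 2}" "c \<in> {1..r 3}"
  using idx_triple[OF assms] idx_bounds[OF assms] by (meson atLeastAtMost_iff)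

lemma sw_triple [simp]:
  "sw 1 (triple p q c) a = triple (a 1) q c"
  "sw (Suc 0) (triple p q c) a = triple (a 1) q c"
  "sw 2 (triple p q c) a = triple p (a 2) c"
  "sw 3 (triple p q c) a = triple p q (a 3)"
  by (auto simp: sw_def triple_def fun_eq_iff)

lemma dst_triple:
  "dst (triple p q c) (triple p' q' c') =
    (if p = p' then 0 else 1) + (if q = q' then 0 else 1) + (if c = c' then 0 else 1)"
proof -
  have "{i \<in> {1..3}. triple p q c i \<noteq> triple p' q' c' i} =
      (if p = p' then {} else {1}) \<union> (if q = q' then {} else {2}) \<union> (if c = c' then {} else {3})"
    unfolding three by auto
  then show ?thesis unfolding dst_def by simp
qed

text \<open>The class that becomes column \<open>k\<close>, row \<open>c\<close> of the grid; the shift by two makes columns start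
  at zero. Outside the grid the class is empty.\<close>

definition cl :: "nat \<Rightarrow> nat \<Rightarrow> (nat \<Rightarrow> nat) set" where
  "cl k c = {a \<in> idx r. a 1 + a 2 = k + 2 \<and> a 3 = c}"

text \<open>All members of a class have the same coordinates, so an arbitrary representative serves.\<close>

definition coord :: "(nat \<Rightarrow> nat) set \<Rightarrow> nat \<times> nat" where
  "coord Q = (let a = SOME a. a \<in> Q in (a 1 + a 2 - 2, a 3))"

definition y :: "nat \<Rightarrow> nat \<Rightarrow> ((nat \<Rightarrow> nat) set, 'k::field) mpoly" where
  "y k c = mpoly_var (cl k c)"

definition grid :: "(nat \<times> nat) set" where
  "grid = {..deg} \<times> {1..r 3}"

lemma mem_grid [simp]: "(k, c) \<in> grid \<longleftrightarrow> k \<le> deg \<and> 1 \<le> c \<and> c \<le> r 3"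
  by (auto simp: grid_def)

lemma exists_triple:
  assumes "k \<le> deg"
  obtains p q where "p \<in> {1..r 1}" "q \<in> {1..r 2}" "p + q = k + 2"
proof
  \<comment> \<open>Filling the first coordinate first leaves a positive second coordinate.\<close>
  show "min (k + 1) (r 1) \<in> {1..r 1}" "k + 2 - min (k + 1) (r 1) \<in> {1..r 2}"
    "min (k + 1) (r 1) + (k + 2 - min (k + 1) (r 1)) = k + 2"
    using assms r1 r2 by (auto simp: deg_def min_def)
qed

lemma coord_cl [simp]: "(k, c) \<in> grid \<Longrightarrow> coord (cl k c) = (k, c)"
proof -
  assume "(k, c) \<in> grid"
  then obtain p q where "p \<in> {1..r 1}" "q \<in> {1..r 2}" "p + q = k + 2" and c: "1 \<le> c" "c \<le> r 3"
    using exists_triple by auto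
  then have "triple p q c \<in> cl k c"
    by (simp add: cl_def)
  then have "(SOME a. a \<in> cl k c) \<in> cl k c"
    by (rule someI[of "\<lambda>a. a \<in> cl k c"])
  then show ?thesis
    by (simp add: coord_def Let_def cl_def)
qed

lemma equiv2_class: "a \<in> idx r \<Longrightarrow> equiv2 r `` {a} = cl (a 1 + a 2 - 2) (a 3)"
  using idx_bounds[of a] by (auto simp: equiv2_def cl_def)

lemma coord_class_in_grid: "a \<in> idx r \<Longrightarrow> (a 1 + a 2 - 2, a 3) \<in> grid"
  using idx_bounds[of a] by (auto simp: deg_def)

lemma xv_triple:
  "triple p q c \<in> idx r \<Longrightarrow> xv r (triple p q c) = y (p + q - 2) c"
  using equiv2_class[of "triple p q c"] by (simp add: xv_def y_def del: triple_in_idx)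

lemma variables_eq: "variables r = (\<lambda>(k, c). cl k c) ` grid"
proof (intro Set.set_eqI iffI)
  fix Q assume "Q \<in> variables r"
  then obtain a where a: "a \<in> idx r" "Q = equiv2 r `` {a}"
    by (auto simp: quotient_def)
  then show "Q \<in> (\<lambda>(k, c). cl k c) ` grid"
    using coord_class_in_grid[OF a(1)] equiv2_class[OF a(1)] by (intro image_eqI) auto
next
  fix Q assume "Q \<in> (\<lambda>(k, c). cl k c) ` grid"
  then obtain k c where kc: "(k, c) \<in> grid" "Q = cl k c" by auto
  then obtain p q where pq: "p \<in> {1..r 1}" "q \<in> {1..r 2}" "p + q = k + 2"
    using exists_triple by auto
  then have "triple p q c \<in> idx r" using kc by simp
  then show "Q \<in> variables r"
    using equiv2_class[of "triple p q c"] quotientI[of "triple p q c" "idx r" "equiv2 r"] kc pq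
    by (simp del: triple_in_idx)
qed

lemma cl_in_variables: "(k, c) \<in> grid \<Longrightarrow> cl k c \<in> variables r"
  unfolding variables_eq by force

lemma y_in_carrier: "(k, c) \<in> grid \<Longrightarrow> y k c \<in> carrier (Rng r)"
  unfolding y_def Rng_def by (intro mpoly_var_in_carrier cl_in_variables)

lemma xv_in_carrier: "a \<in> idx r \<Longrightarrow> xv r a \<in> carrier (Rng r)"
  by (simp add: xv_def Rng_def mpoly_var_in_carrier quotientI)

text \<open>Switching the first or second coordinate moves weight between the two factors inside their
  rows; switching the third coordinate gives, up to the order of the factors, the same shape. So
  every generator is a quadratic binomial that keeps the rows and the total weight.\<close>

lemma fgen_shape:
  assumes "a \<in> idx r" "b \<in> idx r" "i \<in> {1..3}"
  obtains k l k' l' c e where "k + l = k' + l'" "(k, c) \<in> grid" "(l, e) \<in> grid"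
    "(k', c) \<in> grid" "(l', e) \<in> grid"
    "(fgen r i a b :: ((nat \<Rightarrow> nat) set, 'k::field) mpoly) = y k c * y l e - y k' c * y l' e"
proof -
  obtain p q c where a: "a = triple p q c" "p \<in> {1..r 1}" "q \<in> {1..r 2}" "c \<in> {1..r 3}"
    using assms(1) idxE by blast
  obtain p' q' e where b: "b = triple p' q' e" "p' \<in> {1..r 1}" "q' \<in> {1..r 2}" "e \<in> {1..r 3}"
    using assms(2) idxE by blast
  note simps = a b fgen_def xv_triple deg_def
  from assms(3) consider "i = 1" | "i = 2" | "i = 3" unfolding three by blast
  then show thesis
  proof cases
    case 1
    show thesis
      by (rule that[of "p + q - 2" "p' + q' - 2" "p' + q - 2" "p + q' - 2" c e])
        (use 1 a(2-) b(2-) in \<open>auto simp: simps\<close>)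
  next
    case 2
    show thesis
      by (rule that[of "p + q - 2" "p' + q' - 2" "p + q' - 2" "p' + q - 2" c e])
        (use 2 a(2-) b(2-) in \<open>auto simp: simps\<close>)
  next
    case 3
    show thesis
      by (rule that[of "p + q - 2" "p' + q' - 2" "p' + q' - 2" "p + q - 2" c e])
        (use 3 a(2-) b(2-) in \<open>auto simp: simps\<close>)
  qed
qed

lemma fgen_in_carrier:
  assumes "a \<in> idx r" "b \<in> idx r" "i \<in> {1..3}"
  shows "(fgen r i a b :: ((nat \<Rightarrow> nat) set, 'k::field) mpoly) \<in> carrier (Rng r)"
proof -
  obtain k l k' l' c e where "k + l = k' + l'"
    and g: "(k, c) \<in> grid" "(l, e) \<in> grid" "(k', c) \<in> grid" "(l', e) \<in> grid"
    and f: "(fgen r i a b :: ((nat \<Rightarrow> nat) set, 'k) mpoly) = y k c * y l e - y k' c * y l' e"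
    using assms by (rule fgen_shape)
  show ?thesis
    using g[THEN y_in_carrier] unfolding f Rng_def by auto
qed

section \<open>Exchange ideals\<close>

text \<open>Closure under moving one unit of weight between two factors. Unlike the generators of
  \<open>I2_tilde\<close>, this property does not depend on \<open>t\<close> or on how \<open>k\<close> splits into \<open>a 1\<close> and \<open>a 2\<close>, and
  it is what can be verified for prime ideals above \<open>I2\<close>.\<close>

definition exchange_ideal :: "((nat \<Rightarrow> nat) set, 'k::field) mpoly set \<Rightarrow> bool" where
  "exchange_ideal J \<longleftrightarrow> ideal J (Rng r) \<and>
     (\<forall>k<deg. \<forall>l<deg. \<forall>c\<in>{1..r 3}. \<forall>e\<in>{1..r 3}.
        y k c * y (Suc l) e - y (Suc k) c * y l e \<in> J)"

abbreviation ymon :: "(nat \<times> nat) multiset \<Rightarrow> ((nat \<Rightarrow> nat) set, 'k::field) mpoly" where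
  "ymon M \<equiv> \<Prod>(k, c)\<in>#M. y k c"

abbreviation weight :: "(nat \<times> nat) multiset \<Rightarrow> nat" where
  "weight M \<equiv> \<Sum>x\<in>#M. fst x"

lemma ymon_in_carrier: "set_mset M \<subseteq> grid \<Longrightarrow> ymon M \<in> carrier (Rng r)"
  by (induction M) (auto simp: Rng_def intro!: carrier_mpoly_ring_closed y_in_carrier[unfolded Rng_def])

text \<open>Any factor \<open>y k c\<close> that occurs in some monomial \<open>N\<close> with the same rows and weight can be split off
  \<open>M\<close>. Start from a factor \<open>y k0 c\<close> of \<open>M\<close>. While \<open>k0 < k\<close>, some other factor of \<open>M\<close> has a positive
  column to give away, since otherwise the weight of \<open>M\<close> would be smaller than that of \<open>N\<close>; while
  \<open>k0 > k\<close>, some other factor is not yet in the last column.\<close>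

lemma exchange_extract:
  fixes J :: "((nat \<Rightarrow> nat) set, 'k::field) mpoly set"
  assumes J: "exchange_ideal J"
    and "set_mset M \<subseteq> grid" "set_mset N \<subseteq> grid" "(k0, c) \<in># M" "(k, c) \<in># N"
    and "image_mset snd M = image_mset snd N" "weight M = weight N"
  shows "\<exists>M'. set_mset M' \<subseteq> grid \<and> ymon M - y k c * ymon M' \<in> J \<and>
    image_mset snd M = add_mset c (image_mset snd M') \<and> weight M = k + weight M'"
  using assms(2-)
proof (induction "(k0 - k) + (k - k0)" arbitrary: M k0 rule: less_induct)
  case less
  have idl: "ideal J (mpoly_ring (variables r))"
    using J by (simp add: exchange_ideal_def Rng_def)
  obtain M0 where M0: "M = add_mset (k0, c) M0" using less.prems(3) by (metis mset_add)
  obtain N0 where N0: "N = add_mset (k, c) N0" using less.prems(4) by (metis mset_add)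
  have rows: "image_mset snd M0 = image_mset snd N0" using less.prems(5) M0 N0 by simp
  have wt: "k0 + weight M0 = k + weight N0" using less.prems(6) M0 N0 by simp
  \<comment> \<open>The move replaces \<open>(k0, c), (l, e)\<close> by \<open>(k1, c), (l1, e)\<close>.\<close>
  have move: ?case
    if M1: "M0 = add_mset (l, e) M1" and k1: "(k1 - k) + (k - k1) < (k0 - k) + (k - k0)"
      and le: "k1 \<le> deg" "l1 \<le> deg" and sum: "k1 + l1 = k0 + l"
      and ex: "y k0 c * y l e - y k1 c * y l1 e \<in> J" for k1 l1 l e M1
  proof -
    let ?M = "add_mset (k1, c) (add_mset (l1, e) M1)"
    have M: "M = add_mset (k0, c) (add_mset (l, e) M1)" using M0 M1 by simp
    have grid: "set_mset ?M \<subseteq> grid" using less.prems(1) le M by auto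
    have "set_mset M1 \<subseteq> grid" using less.prems(1) M by auto
    then have "ymon M1 * (y k0 c * y l e - y k1 c * y l1 e) \<in> J"
      using ideal_mult[OF idl ex] ymon_in_carrier[of M1] by (simp add: Rng_def)
    then have eq: "ymon M - ymon ?M \<in> J"
      by (simp add: M algebra_simps)
    have "image_mset snd ?M = image_mset snd N" "weight ?M = weight N"
      using less.prems(5,6) M sum by auto
    then obtain M' where "set_mset M' \<subseteq> grid" "ymon ?M - y k c * ymon M' \<in> J"
      "image_mset snd ?M = add_mset c (image_mset snd M')" "weight ?M = k + weight M'"
      using less.hyps[OF k1 grid less.prems(2) _ less.prems(4)] by auto
    then show ?case
      using ideal_diff_trans[OF idl eq] M sum by (intro exI[of _ M']) auto
  qed
  consider "k0 = k" | "k0 < k" | "k < k0" by linarith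
  then show ?case
  proof cases
    case 1
    then show ?thesis
      using M0 less.prems(1) ideal_zero[OF idl] by (intro exI[of _ M0]) auto
  next
    case 2
    then have "weight M0 \<noteq> 0" using wt by linarith
    then have "\<exists>x\<in>#M0. fst x \<noteq> 0" by (induction M0) auto
    then obtain l e where le: "(l, e) \<in># M0" "l \<noteq> 0" by auto
    obtain M1 where M1: "M0 = add_mset (l, e) M1" using le by (metis mset_add)
    have g: "l \<le> deg" "1 \<le> e" "e \<le> r 3" "1 \<le> c" "c \<le> r 3" "k \<le> deg"
      using less.prems(1,2,4) M0 M1 by auto
    show ?thesis
    proof (rule move[OF M1, of "Suc k0" "l - 1"])
      have "\<forall>k<deg. \<forall>l<deg. y k c * y (Suc l) e - y (Suc k) c * y l e \<in> J"
        using J g by (auto simp: exchange_ideal_def)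
      from this[rule_format, of k0 "l - 1"] show "y k0 c * y l e - y (Suc k0) c * y (l - 1) e \<in> J"
        using 2 g le by simp
    qed (use 2 g le in auto)
  next
    case 3
    have "size M0 = size N0" using rows by (metis size_image_mset)
    have "weight N0 \<le> size N0 * deg"
      using less.prems(2) unfolding N0 by (induction N0) auto
    moreover have "weight M0 < weight N0" using wt 3 by simp
    ultimately have lt: "weight M0 < size M0 * deg" using \<open>size M0 = size N0\<close> by simp
    have "\<exists>x\<in>#M0. fst x < deg"
    proof (rule ccontr)
      assume "\<not> ?thesis"
      then have "size M0 * deg \<le> weight M0" by (induction M0) (auto simp: not_less)
      then show False using lt by simp
    qed
    then obtain l e where le: "(l, e) \<in># M0" "l < deg" by auto
    obtain M1 where M1: "M0 = add_mset (l, e) M1" using le by (metis mset_add)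
    have g: "1 \<le> e" "e \<le> r 3" "1 \<le> c" "c \<le> r 3" "k0 \<le> deg"
      using less.prems(1) M0 M1 by auto
    show ?thesis
    proof (rule move[OF M1, of "k0 - 1" "Suc l"])
      have "\<forall>k<deg. \<forall>l<deg. y k c * y (Suc l) e - y (Suc k) c * y l e \<in> J"
        using J g by (auto simp: exchange_ideal_def)
      from this[rule_format, of "k0 - 1" l] have "y (k0 - 1) c * y (Suc l) e - y k0 c * y l e \<in> J"
        using 3 g le by simp
      then show "y k0 c * y l e - y (k0 - 1) c * y (Suc l) e \<in> J"
        by (rule ideal_diff_commute[OF idl])
    qed (use 3 g le in auto)
  qed
qed

text \<open>Splitting off the factors of \<open>N\<close> one after the other turns \<open>M\<close> into \<open>N\<close>.\<close>

lemma exchange_monomials: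
  fixes J :: "((nat \<Rightarrow> nat) set, 'k::field) mpoly set"
  assumes J: "exchange_ideal J"
    and "set_mset M \<subseteq> grid" "set_mset N \<subseteq> grid"
    and "image_mset snd M = image_mset snd N" "weight M = weight N"
  shows "ymon M - ymon N \<in> J"
  using assms(2-)
proof (induction N arbitrary: M)
  have idl: "ideal J (mpoly_ring (variables r))"
    using J by (simp add: exchange_ideal_def Rng_def)
  case empty
  then show ?case using ideal_zero[OF idl] by simp
next
  have idl: "ideal J (mpoly_ring (variables r))"
    using J by (simp add: exchange_ideal_def Rng_def)
  case (add x N)
  obtain k c where x: "x = (k, c)" by fastforce
  have "c \<in># image_mset snd M" using add.prems(3) x by simp
  then obtain k0 where k0: "(k0, c) \<in># M" by auto
  obtain M' where M': "set_mset M' \<subseteq> grid" "ymon M - y k c * ymon M' \<in> J"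
    "image_mset snd M = add_mset c (image_mset snd M')" "weight M = k + weight M'"
    using exchange_extract[OF J add.prems(1,2) k0 _ add.prems(3,4), of k] x by auto
  have "ymon M' - ymon N \<in> J"
    using add.IH[OF M'(1)] M' add.prems x by simp
  moreover have "y k c \<in> carrier (mpoly_ring (variables r))"
    using y_in_carrier[of k c] add.prems(2) x by (simp add: Rng_def)
  ultimately have "y k c * ymon M' - y k c * ymon N \<in> J"
    by (rule ideal_diff_mult[OF idl])
  then show ?case using ideal_diff_trans[OF idl M'(2)] x by simp
qed

lemma ring_Rng: "ring (Rng r)" and cring_Rng: "cring (Rng r)"
  unfolding Rng_def by (rule ring_mpoly_ring cring_mpoly_ring)+

lemma ideal_Rng: "ideal J (Rng r) \<Longrightarrow> ideal J (mpoly_ring (variables r))"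
  by (simp add: Rng_def)

text \<open>A single switch of first coordinates moves one unit of weight when the two row indices are
  close. When they are far apart, both sides can be switched to the same product
  \<open>y (l + r 2 - 1) c * y (k + 2 - r 2) e\<close>.\<close>

lemma exchange_close:
  assumes sf: "\<And>p q p' q'. p \<in> {1..r 1} \<Longrightarrow> q \<in> {1..r 2} \<Longrightarrow> p' \<in> {1..r 1} \<Longrightarrow> q' \<in> {1..r 2} \<Longrightarrow>
      y (p + q - 2) c * y (p' + q' - 2) e - y (p' + q - 2) c * y (p + q' - 2) e \<in> J"
    and "k < deg" "l < deg" "k < l + r 2" "l < k + r 2"
  shows "y k c * y (Suc l) e - y (Suc k) c * y l e \<in> J"
proof -
  \<comment> \<open>Both \<open>k + 2\<close> and \<open>l + 2\<close> need a valid second coordinate next to the first coordinate \<open>p\<close>, and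
      \<open>Suc p\<close> must be a valid first coordinate; the largest \<open>p\<close> below these bounds works.\<close>
  define p where "p = min (Suc (min k l)) (r 1 - 1)"
  have p: "1 \<le> p" "Suc p \<le> r 1" "p \<le> Suc k" "p \<le> Suc l" "k + 2 - p \<le> r 2" "l + 2 - p \<le> r 2"
    using assms(2-) r1 r2 unfolding p_def deg_def by auto
  show ?thesis
    using sf[of p "k + 2 - p" "Suc p" "l + 2 - p"] p assms(2-)
    by (simp add: Suc_diff_le)
qed

lemma exchange_far:
  assumes J: "ideal J (Rng r)"
    and sf: "\<And>p q p' q'. p \<in> {1..r 1} \<Longrightarrow> q \<in> {1..r 2} \<Longrightarrow> p' \<in> {1..r 1} \<Longrightarrow> q' \<in> {1..r 2} \<Longrightarrow>
      y (p + q - 2) c * y (p' + q' - 2) e - y (p' + q - 2) c * y (p + q' - 2) e \<in> J"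
    and "k < deg" "l < deg" "l + r 2 \<le> k"
  shows "y k c * y (Suc l) e - y (Suc k) c * y l e \<in> J"
proof -
  define m where "m = k + 2 - r 2"
  have m: "m + r 2 = k + 2" "1 \<le> m" "Suc m \<le> r 1" "Suc l \<le> r 1"
    using assms(3-) r2 unfolding m_def deg_def by auto
  have "y k c * y (Suc l) e - y (l + r 2 - 1) c * y m e \<in> J"
    using sf[of m "r 2" "Suc l" 2] m r2 by simp
  moreover have "y (Suc k) c * y l e - y (l + r 2 - 1) c * y m e \<in> J"
    using sf[of "Suc m" "r 2" "Suc l" 1] m r2 by simp
  ultimately show ?thesis
    using ideal_diff[OF ideal_Rng[OF J]] by fastforce
qed

text \<open>The rows are restricted to a set \<open>C\<close>: it is the set of all rows for \<open>I2_tilde\<close>, and a single row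
  for a prime above \<open>I2\<close>.\<close>

lemma exchange_of_switches:
  assumes J: "ideal J (Rng r)" and ce: "c \<in> C" "e \<in> C"
    and sf: "\<And>p q p' q' c e. p \<in> {1..r 1} \<Longrightarrow> q \<in> {1..r 2} \<Longrightarrow> p' \<in> {1..r 1} \<Longrightarrow> q' \<in> {1..r 2} \<Longrightarrow>
      c \<in> C \<Longrightarrow> e \<in> C \<Longrightarrow>
      y (p + q - 2) c * y (p' + q' - 2) e - y (p' + q - 2) c * y (p + q' - 2) e \<in> J"
    and kl: "k < deg" "l < deg"
  shows "y k c * y (Suc l) e - y (Suc k) c * y l e \<in> J"
proof -
  consider "k < l + r 2 \<and> l < k + r 2" | "l + r 2 \<le> k" | "k + r 2 \<le> l" by linarith
  then show ?thesis
  proof cases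
    case 1
    show ?thesis by (rule exchange_close) (use sf ce kl 1 in auto)
  next
    case 2
    show ?thesis by (rule exchange_far[OF J]) (use sf ce kl 2 in auto)
  next
    case 3
    have "y l e * y (Suc k) c - y (Suc l) e * y k c \<in> J"
      by (rule exchange_far[OF J]) (use sf ce kl 3 in auto)
    from ideal_diff_commute[OF ideal_Rng[OF J] this]
    show ?thesis by (simp add: mult.commute)
  qed
qed

text \<open>In particular an exchange ideal contains every binomial of the shape shared by all the
  \<open>f\<^sub>i\<^sub>,\<^sub>a\<^sub>,\<^sub>b\<close>.\<close>

lemma exchange_fgen:
  fixes J :: "((nat \<Rightarrow> nat) set, 'k::field) mpoly set"
  assumes J: "exchange_ideal J" and "a \<in> idx r" "b \<in> idx r" "i \<in> {1..3}"
  shows "fgen r i a b \<in> J"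
proof -
  obtain k l k' l' c e where kl: "k + l = k' + l'"
    and g: "(k, c) \<in> grid" "(l, e) \<in> grid" "(k', c) \<in> grid" "(l', e) \<in> grid"
    and f: "(fgen r i a b :: ((nat \<Rightarrow> nat) set, 'k) mpoly) = y k c * y l e - y k' c * y l' e"
    using assms(2-) by (rule fgen_shape)
  show ?thesis
    using exchange_monomials[OF J, of "{#(k, c), (l, e)#}" "{#(k', c), (l', e)#}"] kl g
    by (simp add: f)
qed

context
  fixes t :: nat
  assumes t: "t \<in> {1..3}"
begin

lemma generators_in_carrier:
  "{fgen r i a b | i a b. i \<in> {1..t} \<and> a \<in> idx r \<and> b \<in> idx r} \<subseteq> carrier (Rng r)"
  "{fgen r i a b | i a b. i \<in> {1..t} \<and> a \<in> idx r \<and> b \<in> idx r \<and> dst a b = 2} \<subseteq> carrier (Rng r)"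
  using t by (auto intro!: fgen_in_carrier)

lemma ideal_I2_tilde: "ideal (I2_tilde r t) (Rng r)"
  unfolding I2_tilde_def
  by (rule ring.genideal_ideal[OF ring_Rng], rule generators_in_carrier)

lemma I2_tilde_subset_exchange_ideal:
  "exchange_ideal J \<Longrightarrow> I2_tilde r t \<subseteq> J"
  unfolding I2_tilde_def using t
  by (intro ring.genideal_minimal[OF ring_Rng]) (auto simp: exchange_ideal_def exchange_fgen)

lemma fgen_in_I2_tilde:
  "i \<in> {1..t} \<Longrightarrow> a \<in> idx r \<Longrightarrow> b \<in> idx r \<Longrightarrow> fgen r i a b \<in> I2_tilde r t"
  using ring.genideal_self[OF ring_Rng generators_in_carrier(1)] unfolding I2_tilde_def by blast

lemma fgen_in_I2:
  "i \<in> {1..t} \<Longrightarrow> a \<in> idx r \<Longrightarrow> b \<in> idx r \<Longrightarrow> dst a b = 2 \<Longrightarrow> fgen r i a b \<in> I2 r t"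
  using ring.genideal_self[OF ring_Rng generators_in_carrier(2)] unfolding I2_def by blast

lemma I2_subset_I2_tilde: "I2 r t \<subseteq> (I2_tilde r t :: ((nat \<Rightarrow> nat) set, 'k::field) mpoly set)"
  unfolding I2_def by (intro ring.genideal_minimal[OF ring_Rng] ideal_I2_tilde)
    (auto intro: fgen_in_I2_tilde)

lemma switch_first_in_I2_tilde:
  fixes p q c p' q' e :: nat
  assumes "p \<in> {1..r 1}" "q \<in> {1..r 2}" "c \<in> {1..r 3}"
    and "p' \<in> {1..r 1}" "q' \<in> {1..r 2}" "e \<in> {1..r 3}"
  shows "y (p + q - 2) c * y (p' + q' - 2) e - y (p' + q - 2) c * y (p + q' - 2) e
    \<in> I2_tilde r t"
proof -
  have "1 \<in> {1..t}" using t by simp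
  then show ?thesis
    using fgen_in_I2_tilde[of 1 "triple p q c" "triple p' q' e"] assms
    by (simp add: fgen_def xv_triple)
qed

lemma exchange_ideal_I2_tilde:
  "exchange_ideal (I2_tilde r t :: ((nat \<Rightarrow> nat) set, 'k::field) mpoly set)"
  unfolding exchange_ideal_def
  by (intro conjI ballI allI impI ideal_I2_tilde
    exchange_of_switches[where C = "{1..r 3}"] switch_first_in_I2_tilde) auto

end

text \<open>Modulo the exchange ideal a monomial is determined by its rows and its weight, which is what
  \<open>y k c \<mapsto> u\<^sup>k z\<^sub>c\<close> records (with variable \<open>0\<close> in the role of \<open>u\<close>). So \<open>I2_tilde\<close> is the
  kernel of this map into a domain.\<close>

definition toric_exponent :: "(nat \<Rightarrow> nat) set \<Rightarrow> nat \<Rightarrow>\<^sub>0 nat" where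
  "toric_exponent Q = (case coord Q of (k, c) \<Rightarrow> Poly_Mapping.single 0 k + Poly_Mapping.single c 1)"

definition toric :: "(nat \<Rightarrow> nat) set \<Rightarrow> (nat, 'k::field) mpoly" where
  "toric Q = Poly_Mapping.single (toric_exponent Q) 1"

lemma eval_toric_y:
  "(k, c) \<in> grid \<Longrightarrow> mpoly_eval toric (y k c :: ((nat \<Rightarrow> nat) set, 'k::field) mpoly) =
     Poly_Mapping.single (Poly_Mapping.single 0 k + Poly_Mapping.single c 1) 1"
  by (simp add: y_def toric_def toric_exponent_def del: mem_grid)

lemma variablesE:
  assumes "Q \<in> variables r"
  obtains k c where "(k, c) \<in> grid" "coord Q = (k, c)" "mpoly_var Q = (y k c :: ((nat \<Rightarrow> nat) set, 'k::field) mpoly)"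
  using assms unfolding variables_eq y_def by (auto simp del: mem_grid)

lemma prod_vars_eq_ymon:
  assumes "set_mset M \<subseteq> variables r"
  shows "set_mset (image_mset coord M) \<subseteq> grid"
    and "(\<Prod>Q\<in>#M. mpoly_var Q :: ((nat \<Rightarrow> nat) set, 'k::field) mpoly) = ymon (image_mset coord M)"
proof -
  have "coord Q \<in> grid \<and> mpoly_var Q = ((case coord Q of (k, c) \<Rightarrow> y k c) :: ((nat \<Rightarrow> nat) set, 'k::field) mpoly)"
    if Q: "Q \<in># M" for Q
  proof -
    obtain k c where "(k, c) \<in> grid" "coord Q = (k, c)"
      "mpoly_var Q = (y k c :: ((nat \<Rightarrow> nat) set, 'k) mpoly)"
      by (rule variablesE) (use Q assms in auto)
    then show ?thesis by simp
  qed
  note * = this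
  show "set_mset (image_mset coord M) \<subseteq> grid" using * by auto
  have "image_mset mpoly_var M = image_mset (\<lambda>Q. (case coord Q of (k, c) \<Rightarrow> y k c) :: ((nat \<Rightarrow> nat) set, 'k) mpoly) M"
    by (rule image_mset_cong) (use * in blast)
  then show "(\<Prod>Q\<in>#M. mpoly_var Q :: ((nat \<Rightarrow> nat) set, 'k::field) mpoly) = ymon (image_mset coord M)"
    by (simp add: multiset.map_comp comp_def)
qed

lemma toric_exponent_sum:
  assumes "set_mset (image_mset coord M) \<subseteq> grid"
  shows "Poly_Mapping.lookup (\<Sum>Q\<in>#M. toric_exponent Q) 0 = weight (image_mset coord M)"
    and "c \<noteq> 0 \<Longrightarrow> Poly_Mapping.lookup (\<Sum>Q\<in>#M. toric_exponent Q) c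
      = count (image_mset snd (image_mset coord M)) c"
  using assms
  by (induction M) (auto simp: lookup_add toric_exponent_def lookup_single split: prod.splits)

lemma I2_tilde_eq_kernel:
  assumes t: "t \<in> {1..3}"
  shows "(I2_tilde r t :: ((nat \<Rightarrow> nat) set, 'k::field) mpoly set)
    = {p \<in> carrier (Rng r). mpoly_eval toric p = 0}"
proof -
  let ?J = "I2_tilde r t :: ((nat \<Rightarrow> nat) set, 'k::field) mpoly set"
  have toric_eq: "toric = (\<lambda>Q. if Q \<in> {} then 0 else Poly_Mapping.single (toric_exponent Q) (1::'k))"
    by (auto simp: toric_def)
  have fgen_zero: "mpoly_eval toric (fgen r i a b :: ((nat \<Rightarrow> nat) set, 'k) mpoly) = 0"
    if abi: "a \<in> idx r" "b \<in> idx r" "i \<in> {1..3}" for i a b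
  proof -
    obtain k l k' l' c e where kl: "k + l = k' + l'"
      and g: "(k, c) \<in> grid" "(l, e) \<in> grid" "(k', c) \<in> grid" "(l', e) \<in> grid"
      and f: "(fgen r i a b :: ((nat \<Rightarrow> nat) set, 'k) mpoly) = y k c * y l e - y k' c * y l' e"
      using abi by (rule fgen_shape)
    have "Poly_Mapping.single 0 k + Poly_Mapping.single 0 l =
        Poly_Mapping.single (0::nat) k' + Poly_Mapping.single 0 l'"
      using kl by (simp flip: single_add)
    then have "(Poly_Mapping.single 0 k + Poly_Mapping.single c 1) + (Poly_Mapping.single 0 l + Poly_Mapping.single e 1)
      = (Poly_Mapping.single 0 k' + Poly_Mapping.single c 1) + (Poly_Mapping.single (0::nat) l' + Poly_Mapping.single e (1::nat))"
      by (metis (no_types, lifting) add.assoc add.left_commute)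
    then show ?thesis
      unfolding f mpoly_eval_diff mpoly_eval_mult g[THEN eval_toric_y] by (simp add: mult_single)
  qed
  have sub: "?J \<subseteq> {p \<in> carrier (Rng r). mpoly_eval toric p = 0}"
    unfolding I2_tilde_def
  proof (rule ring.genideal_minimal[OF ring_Rng])
    show "ideal {p \<in> carrier (Rng r). mpoly_eval toric p = (0 :: (nat, 'k) mpoly)} (Rng r)"
      unfolding Rng_def by (rule primeideal.axioms(1)[OF primeideal_eval_kernel])
    show "{fgen r i a b | i a b. i \<in> {1..t} \<and> a \<in> idx r \<and> b \<in> idx r}
        \<subseteq> {p \<in> carrier (Rng r). mpoly_eval toric p = (0 :: (nat, 'k) mpoly)}"
      using t by (auto intro!: fgen_zero fgen_in_carrier)
  qed
  have "?J = {p \<in> carrier (mpoly_ring (variables r)). mpoly_eval toric p = 0}"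
    unfolding toric_eq
  proof (rule monomial_map_kernel)
    show "ideal ?J (mpoly_ring (variables r))"
      using ideal_I2_tilde[OF t] by (rule ideal_Rng)
    fix M N assume M: "set_mset M \<subseteq> variables r - {}" and N: "set_mset N \<subseteq> variables r - {}"
      and sum: "(\<Sum>Q\<in>#M. toric_exponent Q) = (\<Sum>Q\<in>#N. toric_exponent Q)"
    let ?M = "image_mset coord M" and ?N = "image_mset coord N"
    have grid: "set_mset ?M \<subseteq> grid" "set_mset ?N \<subseteq> grid"
      using prod_vars_eq_ymon(1) M N by auto
    have "image_mset snd ?M = image_mset snd ?N"
    proof (rule multiset_eqI)
      fix c show "count (image_mset snd ?M) c = count (image_mset snd ?N) c"
      proof (cases "c = 0")
        case True
        \<comment> \<open>Exponent \<open>0\<close> records the weight, but there is no row \<open>0\<close>.\<close>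
        have "0 \<notin># image_mset snd K" if "set_mset K \<subseteq> grid" for K
          using that by force
        from this[OF grid(1)] this[OF grid(2)] show ?thesis
          using True by (simp only: not_in_iff)
      next
        case False
        then show ?thesis using toric_exponent_sum(2)[OF grid(1)] toric_exponent_sum(2)[OF grid(2)] sum by simp
      qed
    qed
    moreover have "weight ?M = weight ?N"
      using toric_exponent_sum(1)[OF grid(1)] toric_exponent_sum(1)[OF grid(2)] sum by simp
    ultimately have "ymon ?M - ymon ?N \<in> ?J"
      by (rule exchange_monomials[OF exchange_ideal_I2_tilde[OF t] grid])
    then show "(\<Prod>Q\<in>#M. mpoly_var Q) - (\<Prod>Q\<in>#N. mpoly_var Q) \<in> ?J"
      using prod_vars_eq_ymon(2)[of M, where 'k = 'k]
        prod_vars_eq_ymon(2)[of N, where 'k = 'k] M N by simp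
  qed (use sub toric_eq in auto)
  then show ?thesis by (simp add: Rng_def)
qed

section \<open>The monomial primes\<close>

text \<open>The column of the one variable of row \<open>c\<close> that is not in the ideal of \<open>\<phi>\<close>.\<close>

definition level :: "(nat \<Rightarrow> nat \<times> nat) \<Rightarrow> nat \<Rightarrow> nat" where
  "level \<phi> c = fst (\<phi> c) + snd (\<phi> c) - 2"

definition corner :: "(nat \<Rightarrow> nat \<times> nat) \<Rightarrow> (nat \<Rightarrow> nat) set \<Rightarrow> (nat, 'k::field) mpoly" where
  "corner \<phi> Q = (if Q \<in> {Q. fst (coord Q) \<noteq> level \<phi> (snd (coord Q))} then 0
     else Poly_Mapping.single (Poly_Mapping.single (snd (coord Q)) 1) 1)"

lemma eval_corner_y:
  "(k, c) \<in> grid \<Longrightarrow> mpoly_eval (corner \<phi>) (y k c :: ((nat \<Rightarrow> nat) set, 'k::field) mpoly) =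
     (if k = level \<phi> c then Poly_Mapping.single (Poly_Mapping.single c 1) 1 else 0)"
  using coord_cl[of k c] by (auto simp: y_def corner_def simp del: mem_grid coord_cl)

context
  fixes \<phi> :: "nat \<Rightarrow> nat \<times> nat"
  assumes \<phi>: "\<phi> \<in> {1..r 3} \<rightarrow>\<^sub>E {(1, 1), (r 1, r 2)}"
begin

lemma phi_cases: "c \<in> {1..r 3} \<Longrightarrow> \<phi> c = (1, 1) \<or> \<phi> c = (r 1, r 2)"
  using \<phi> by (auto simp: PiE_iff)

text \<open>Both corners are alone in their equivalence class, so membership is visible on classes.\<close>

lemma triple_in_S_phi:
  assumes "p \<in> {1..r 1}" "q \<in> {1..r 2}" "c \<in> {1..r 3}"
  shows "triple p q c \<in> S_phi r \<phi> \<longleftrightarrow> p + q - 2 = level \<phi> c"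
  using phi_cases[OF assms(3)] assms r1 r2 by (auto simp: S_phi_def level_def)

lemma level_cases: "c \<in> {1..r 3} \<Longrightarrow> level \<phi> c = 0 \<or> level \<phi> c = deg"
  using phi_cases[of c] by (auto simp: level_def deg_def)

lemma eval_corner_xv_eq_0_iff:
  assumes "a \<in> idx r"
  shows "mpoly_eval (corner \<phi>) (xv r a :: ((nat \<Rightarrow> nat) set, 'k::field) mpoly) = 0 \<longleftrightarrow> a \<notin> S_phi r \<phi>"
proof -
  obtain p q c where a: "a = triple p q c" "p \<in> {1..r 1}" "q \<in> {1..r 2}" "c \<in> {1..r 3}"
    using assms idxE by blast
  then have "(p + q - 2, c) \<in> grid" using r1 r2 by (auto simp: deg_def)
  moreover have "Poly_Mapping.single (Poly_Mapping.single c (1::nat)) (1::'k) \<noteq> 0"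
    by (metis keys_single keys_zero insert_not_empty zero_neq_one)
  ultimately show ?thesis
    using triple_in_S_phi[OF a(2-)] a by (simp add: xv_triple eval_corner_y del: mem_grid)
qed

text \<open>Two elements of \<open>S_phi\<close> over the same corner differ at most in the third coordinate; over
  different corners they differ in all three.\<close>

lemma dst_in_S_phi:
  assumes "a \<in> S_phi r \<phi>" "b \<in> S_phi r \<phi>"
  shows "dst a b \<noteq> 2"
proof -
  obtain p q c where a: "a = triple p q c" "p \<in> {1..r 1}" "q \<in> {1..r 2}" "c \<in> {1..r 3}"
    using assms idxE unfolding S_phi_def by blast
  obtain p' q' c' where b: "b = triple p' q' c'" "p' \<in> {1..r 1}" "q' \<in> {1..r 2}" "c' \<in> {1..r 3}"
    using assms idxE unfolding S_phi_def by blast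
  show ?thesis
    using assms phi_cases[OF a(4)] phi_cases[OF b(4)] r1 r2
    by (auto simp: a(1) b(1) dst_triple S_phi_def)
qed

lemma eval_corner_dst_2:
  assumes "a \<in> idx r" "b \<in> idx r" "dst a b = 2"
  shows "mpoly_eval (corner \<phi>) (xv r a * xv r b :: ((nat \<Rightarrow> nat) set, 'k::field) mpoly) = 0"
  using dst_in_S_phi[of a b] assms eval_corner_xv_eq_0_iff[of a, where 'k = 'k]
    eval_corner_xv_eq_0_iff[of b, where 'k = 'k] by (auto simp: mpoly_eval_mult)

text \<open>A switch preserves the distance, so both terms of the generator vanish.\<close>

lemma eval_corner_fgen_dst_2:
  assumes "a \<in> idx r" "b \<in> idx r" "dst a b = 2" "i \<in> {1..3}"
  shows "mpoly_eval (corner \<phi>) (fgen r i a b :: ((nat \<Rightarrow> nat) set, 'k::field) mpoly) = 0"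
proof -
  obtain p q c where a: "a = triple p q c" "p \<in> {1..r 1}" "q \<in> {1..r 2}" "c \<in> {1..r 3}"
    using assms(1) idxE by blast
  obtain p' q' c' where b: "b = triple p' q' c'" "p' \<in> {1..r 1}" "q' \<in> {1..r 2}" "c' \<in> {1..r 3}"
    using assms(2) idxE by blast
  have i: "i = 1 \<or> i = 2 \<or> i = 3" using assms(4) unfolding three by blast
  have "sw i a b \<in> idx r" "sw i b a \<in> idx r" using i a b by auto
  moreover have "dst (sw i a b) (sw i b a) = 2"
    using i assms(3) unfolding a(1) b(1) 
      by (cases "p = p'"; cases "q = q'"; cases "c = c'") (auto simp: dst_triple)
  ultimately show ?thesis
    unfolding fgen_def mpoly_eval_diff using assms by (simp add: eval_corner_dst_2)
qed

text \<open>Connected elements of \<open>S_phi\<close> differ at most in the third coordinate, so the binomial part of the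
  prime is zero.\<close>

lemma fgen_connected_eq_0:
  assumes "connected_in (S_phi r \<phi>) a b" "i \<in> {1..3}"
  shows "fgen r i a b = 0"
proof -
  have step: "x 1 = z 1 \<and> x 2 = z 2"
    if xz: "x \<in> S_phi r \<phi>" "z \<in> S_phi r \<phi>" "dst x z = 1" for x z
  proof -
    obtain p q c where x: "x = triple p q c" "p \<in> {1..r 1}" "q \<in> {1..r 2}" "c \<in> {1..r 3}"
      using xz idxE unfolding S_phi_def by blast
    obtain p' q' c' where z: "z = triple p' q' c'" "p' \<in> {1..r 1}" "q' \<in> {1..r 2}" "c' \<in> {1..r 3}"
      using xz idxE unfolding S_phi_def by blast
    show ?thesis
      using xz phi_cases[OF x(4)] phi_cases[OF z(4)] r1 r2
      by (cases "p = p'"; cases "q = q'"; cases "c = c'")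
        (auto simp: x(1) z(1) dst_triple S_phi_def)
  qed
  have "(a, b) \<in> {(x, z). x \<in> S_phi r \<phi> \<and> z \<in> S_phi r \<phi> \<and> dst x z = 1}\<^sup>*"
    and ab: "a \<in> S_phi r \<phi>" "b \<in> S_phi r \<phi>"
    using assms by (auto simp: connected_in_def)
  then have eq: "a 1 = b 1 \<and> a 2 = b 2"
    by (induction rule: rtrancl_induct) (use step in auto)
  obtain p q c where a: "a = triple p q c" "p \<in> {1..r 1}" "q \<in> {1..r 2}" "c \<in> {1..r 3}"
    using ab idxE unfolding S_phi_def by blast
  obtain p' q' c' where b: "b = triple p' q' c'" "p' \<in> {1..r 1}" "q' \<in> {1..r 2}" "c' \<in> {1..r 3}"
    using ab idxE unfolding S_phi_def by blast
  have "i = 1 \<or> i = 2 \<or> i = 3" using assms(2) unfolding three by blast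
  then show ?thesis using eq a b by (auto simp: fgen_def xv_triple)
qed

lemma xv_carrier_subset: "{xv r a | a. a \<in> idx r - S_phi r \<phi>} \<subseteq> carrier (Rng r)"
  by (auto intro: xv_in_carrier)

lemma P2_eq_genideal:
  assumes t: "t \<in> {1..3}"
  shows "(P2 r t (S_phi r \<phi>) :: ((nat \<Rightarrow> nat) set, 'k::field) mpoly set)
    = genideal (Rng r) {xv r a | a. a \<in> idx r - S_phi r \<phi>}"
proof -
  let ?B = "{fgen r i a b | i a b. i \<in> {1..t} \<and> connected_in (S_phi r \<phi>) a b}
    :: ((nat \<Rightarrow> nat) set, 'k::field) mpoly set"
  interpret ring "Rng r :: ((nat \<Rightarrow> nat) set, 'k) mpoly ring" by (rule ring_Rng)
  have zero: "\<zero>\<^bsub>Rng r\<^esub> = (0 :: ((nat \<Rightarrow> nat) set, 'k) mpoly)" by (simp add: Rng_def)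
  have B: "?B \<subseteq> {0}"
    using t by (auto intro!: fgen_connected_eq_0)
  have "Idl\<^bsub>Rng r\<^esub> ?B \<subseteq> {0}"
    by (rule genideal_minimal[OF zeroideal, unfolded zero, OF B])
  moreover have "ideal (Idl\<^bsub>Rng r\<^esub> ?B) (Rng r)"
  proof (rule genideal_ideal)
    have "{0} \<subseteq> carrier (Rng r :: ((nat \<Rightarrow> nat) set, 'k) mpoly ring)"
      using zero_closed unfolding zero by simp
    with B show "?B \<subseteq> carrier (Rng r)" by (rule order_trans)
  qed
  then have "0 \<in> Idl\<^bsub>Rng r\<^esub> ?B"
    by (rule ideal_zero[OF ideal_Rng])
  ultimately have "Idl\<^bsub>Rng r\<^esub> ?B = {0}" by blast
  then show ?thesis
    unfolding P2_def set_add_def set_mult_def by (auto simp: Rng_def)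
qed

lemma P2_eq_kernel:
  assumes t: "t \<in> {1..3}"
  shows "(P2 r t (S_phi r \<phi>) :: ((nat \<Rightarrow> nat) set, 'k::field) mpoly set)
    = {p \<in> carrier (Rng r). mpoly_eval (corner \<phi>) p = 0}"
proof -
  let ?X = "{xv r a | a. a \<in> idx r - S_phi r \<phi>} :: ((nat \<Rightarrow> nat) set, 'k::field) mpoly set"
  let ?J = "genideal (Rng r) ?X"
  let ?W = "{Q. fst (coord Q) \<noteq> level \<phi> (snd (coord Q))}"
  have J: "ideal ?J (Rng r)"
    by (rule ring.genideal_ideal[OF ring_Rng xv_carrier_subset])
  have sub: "?J \<subseteq> {p \<in> carrier (Rng r). mpoly_eval (corner \<phi>) p = 0}"
  proof (rule ring.genideal_minimal[OF ring_Rng])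
    show "ideal {p \<in> carrier (Rng r). mpoly_eval (corner \<phi>) p = (0 :: (nat, 'k) mpoly)} (Rng r)"
      unfolding Rng_def by (rule primeideal.axioms(1)[OF primeideal_eval_kernel])
    show "?X \<subseteq> {p \<in> carrier (Rng r). mpoly_eval (corner \<phi>) p = (0 :: (nat, 'k) mpoly)}"
      by (auto simp: eval_corner_xv_eq_0_iff intro: xv_in_carrier)
  qed
  have y_in: "y k c \<in> ?J" if kc: "(k, c) \<in> grid" "k \<noteq> level \<phi> c" for k c
  proof -
    obtain p q where pq: "p \<in> {1..r 1}" "q \<in> {1..r 2}" "p + q = k + 2"
      using exists_triple kc by auto
    have c: "c \<in> {1..r 3}" using kc by simp
    have "triple p q c \<in> idx r - S_phi r \<phi>"
      using triple_in_S_phi[OF pq(1,2) c] pq c kc by simp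
    then have "xv r (triple p q c) \<in> ?J"
      using ring.genideal_self[OF ring_Rng xv_carrier_subset] by blast
    then show ?thesis using pq c by (simp add: xv_triple)
  qed
  have corner_eq: "corner \<phi> = (\<lambda>Q. if Q \<in> ?W then 0
      else Poly_Mapping.single (Poly_Mapping.single (snd (coord Q)) 1) (1::'k))"
    by (auto simp: corner_def)
  have "?J = {p \<in> carrier (mpoly_ring (variables r)). mpoly_eval (corner \<phi>) p = 0}"
    unfolding corner_eq
  proof (rule monomial_map_kernel)
    show J': "ideal ?J (mpoly_ring (variables r))" using J by (rule ideal_Rng)
    show "mpoly_var Q \<in> ?J" if Q: "Q \<in> variables r" "Q \<in> ?W" for Q
    proof -
      obtain k c where "(k, c) \<in> grid" "coord Q = (k, c)"
        "mpoly_var Q = (y k c :: ((nat \<Rightarrow> nat) set, 'k) mpoly)"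
        using Q(1) by (rule variablesE)
      then show ?thesis using y_in Q(2) by simp
    qed
    fix M N assume M: "set_mset M \<subseteq> variables r - ?W" and N: "set_mset N \<subseteq> variables r - ?W"
      and sum: "(\<Sum>Q\<in>#M. Poly_Mapping.single (snd (coord Q)) (1::nat))
        = (\<Sum>Q\<in>#N. Poly_Mapping.single (snd (coord Q)) 1)"
    have count: "Poly_Mapping.lookup (\<Sum>Q\<in>#M. Poly_Mapping.single (snd (coord Q)) (1::nat)) c
        = count (image_mset (snd \<circ> coord) M) c" for M c
      by (induction M) (auto simp: lookup_add lookup_single)
    have rows: "image_mset (snd \<circ> coord) M = image_mset (snd \<circ> coord) N"
      by (rule multiset_eqI) (simp only: count[symmetric] sum)
    have rec: "image_mset coord M = image_mset (\<lambda>c. (level \<phi> c, c)) (image_mset (snd \<circ> coord) M)"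
      if M: "set_mset M \<subseteq> variables r - ?W" for M
      unfolding multiset.map_comp by (rule image_mset_cong) (use M in \<open>auto simp: prod_eq_iff\<close>)
    have "set_mset M \<subseteq> variables r" "set_mset N \<subseteq> variables r"
      using M N by blast+
    moreover have "image_mset coord M = image_mset coord N"
      using rec[OF M] rec[OF N] rows by simp
    ultimately show "(\<Prod>Q\<in>#M. mpoly_var Q) - (\<Prod>Q\<in>#N. mpoly_var Q) \<in> ?J"
      using prod_vars_eq_ymon(2)[of M, where 'k = 'k]
        prod_vars_eq_ymon(2)[of N, where 'k = 'k] ideal_zero[OF J'] by simp
  qed (use sub corner_eq in auto)
  then show ?thesis by (simp add: P2_eq_genideal[OF t] Rng_def)
qed

lemma monomial_ideal_P2:
  assumes t: "t \<in> {1..3}"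
  shows "monomial_ideal (variables r) (P2 r t (S_phi r \<phi>) :: ((nat \<Rightarrow> nat) set, 'k::field) mpoly set)"
  unfolding monomial_ideal_def
proof (intro exI conjI)
  let ?M = "(\<lambda>a. Poly_Mapping.single (equiv2 r `` {a}) 1) ` (idx r - S_phi r \<phi>)"
  show "\<forall>m\<in>?M. Poly_Mapping.keys m \<subseteq> variables r"
    by (auto intro: quotientI)
  have "(\<lambda>m. Poly_Mapping.single m (1::'k)) ` ?M = {xv r a | a. a \<in> idx r - S_phi r \<phi>}"
    by (auto simp: xv_def mpoly_var_def)
  then show "P2 r t (S_phi r \<phi>) = Idl\<^bsub>mpoly_ring (variables r)\<^esub> (\<lambda>m. Poly_Mapping.single m (1::'k)) ` ?M"
    by (simp add: P2_eq_genideal[OF t] Rng_def)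
qed

lemma I2_subset_P2:
  assumes t: "t \<in> {1..3}"
  shows "I2 r t \<subseteq> (P2 r t (S_phi r \<phi>) :: ((nat \<Rightarrow> nat) set, 'k::field) mpoly set)"
  unfolding I2_def P2_eq_kernel[OF t]
proof (rule ring.genideal_minimal[OF ring_Rng])
  show "ideal {p \<in> carrier (Rng r). mpoly_eval (corner \<phi>) p = (0 :: (nat, 'k) mpoly)} (Rng r)"
    unfolding Rng_def by (rule primeideal.axioms(1)[OF primeideal_eval_kernel])
qed (use t in \<open>auto intro!: eval_corner_fgen_dst_2 fgen_in_carrier\<close>)

end

section \<open>Primes above \<open>I2\<close>\<close>

context
  fixes t :: nat and P :: "((nat \<Rightarrow> nat) set, 'k::field) mpoly set"
  assumes t: "t \<in> {1..3}" and P: "primeideal P (Rng r)" and I2_P: "I2 r t \<subseteq> P"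
begin

lemma ideal_P: "ideal P (Rng r)"
  using P by (rule primeideal.axioms(1))

lemmas ideal_P' = ideal_Rng[OF ideal_P]

lemma prime_P:
  "p \<in> carrier (Rng r) \<Longrightarrow> q \<in> carrier (Rng r) \<Longrightarrow> p * q \<in> P \<Longrightarrow> p \<in> P \<or> q \<in> P"
  using primeideal.I_prime[OF P] by (simp add: Rng_def)

lemma y_carrier_P: "k \<le> deg \<Longrightarrow> c \<in> {1..r 3} \<Longrightarrow> y k c \<in> carrier (mpoly_ring (variables r))"
  using y_in_carrier[of k c] by (simp add: Rng_def)

lemma mult_y_in_P:
  assumes "p \<in> P" "k \<le> deg" "c \<in> {1..r 3}"
  shows "y k c * p \<in> P" "p * y k c \<in> P"
  using ideal_mult[OF ideal_P' assms(1) y_carrier_P[OF assms(2,3)]] by (simp_all add: mult.commute)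

text \<open>Adjacent columns share a second coordinate, so a first-coordinate switch across two rows
  is between elements at distance two.\<close>

lemma adjacent_minor_in_P:
  assumes "k < deg" "c \<in> {1..r 3}" "e \<in> {1..r 3}"
  shows "y k c * y (Suc k) e - y (Suc k) c * y k e \<in> P"
proof (cases "c = e")
  case True
  then show ?thesis using ideal_zero[OF ideal_P'] by (simp add: mult.commute)
next
  case False
  \<comment> \<open>The bound \<open>r 1 - 1\<close> leaves room for \<open>Suc p\<close> in column \<open>Suc k\<close>.\<close>
  define p where "p = min (k + 1) (r 1 - 1)"
  have p: "1 \<le> p" "Suc p \<le> r 1" "p \<le> Suc k" "k + 2 - p \<in> {1..r 2}"
    using assms(1) r1 r2 unfolding p_def deg_def by auto
  have "fgen r 1 (triple p (k + 2 - p) c) (triple (Suc p) (k + 2 - p) e) \<in> I2 r t"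
    by (rule fgen_in_I2[OF t]) (use p assms t False in \<open>auto simp: dst_triple\<close>)
  then show ?thesis
    using p assms I2_P by (auto simp: fgen_def xv_triple Suc_diff_le)
qed

text \<open>Inside one row the binomial of a first-coordinate switch is zero, or comes from elements at
  distance two.\<close>

lemma row_exchange_in_P:
  assumes "k < deg" "l < deg" "c \<in> {1..r 3}"
  shows "y k c * y (Suc l) c - y (Suc k) c * y l c \<in> P"
proof (rule exchange_of_switches[OF ideal_P, where C = "{c}"])
  fix p q p' q' c' e
  assume pq: "p \<in> {1..r 1}" "q \<in> {1..r 2}" "p' \<in> {1..r 1}" "q' \<in> {1..r 2}"
    and ce: "c' \<in> {c}" "e \<in> {c}"
  show "y (p + q - 2) c' * y (p' + q' - 2) e - y (p' + q - 2) c' * y (p + q' - 2) e \<in> P"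
  proof (cases "p = p' \<or> q = q'")
    case True
    then show ?thesis using ideal_zero[OF ideal_P'] ce by (auto simp: mult.commute)
  next
    case False
    have "fgen r 1 (triple p q c) (triple p' q' c) \<in> I2 r t"
      by (rule fgen_in_I2[OF t]) (use pq assms t False in \<open>auto simp: dst_triple\<close>)
    then show ?thesis
      using pq assms I2_P ce by (auto simp: fgen_def xv_triple)
  qed
qed (use assms in auto)

text \<open>The square of an inner entry is the product of its neighbours, so a zero at either end of the row
  spreads to all entries but the opposite end.\<close>

lemma square_in_P:
  assumes "Suc k < deg" "c \<in> {1..r 3}" "y k c \<in> P \<or> y (Suc (Suc k)) c \<in> P"
  shows "y (Suc k) c \<in> P"
proof -
  have "y k c * y (Suc (Suc k)) c \<in> P"
    using assms(3,1,2) mult_y_in_P by (elim disjE) simp_all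
  moreover have "y k c * y (Suc (Suc k)) c - y (Suc k) c * y (Suc k) c \<in> P"
    using row_exchange_in_P[of k "Suc k" c] assms by simp
  ultimately have "y (Suc k) c * y (Suc k) c \<in> P"
    using ideal_diff[OF ideal_P'] by fastforce
  then show ?thesis
    using prime_P[of "y (Suc k) c" "y (Suc k) c"] y_in_carrier[of "Suc k" c] assms by auto
qed

lemma row_high:
  assumes "c \<in> {1..r 3}" "y 0 c \<in> P" "k < deg"
  shows "y k c \<in> P"
  using assms(3)
proof (induction k)
  case (Suc k)
  then show ?case using square_in_P[of k c] assms(1) by simp
qed (use assms in simp)

lemma row_low:
  assumes "c \<in> {1..r 3}" "y deg c \<in> P" "0 < k" "k \<le> deg"
  shows "y k c \<in> P"
  using assms(4,3)
proof (induction rule: inc_induct)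
  case (step n)
  then obtain j where "n = Suc j" by (cases n) auto
  then show ?case using square_in_P[of j c] assms(1) step by simp
qed (use assms in simp)

text \<open>Suppose the first vanishing entry were in column \<open>j + 1\<close>. The exchange with the last column makes
  \<open>y j c * y deg c\<close> vanish as well, although neither factor does.\<close>

lemma row_full:
  assumes c: "c \<in> {1..r 3}" and ends: "y 0 c \<notin> P" "y deg c \<notin> P" and "k \<le> deg"
  shows "y k c \<notin> P"
proof
  assume "y k c \<in> P"
  define m where "m = (LEAST m. y m c \<in> P)"
  have m: "y m c \<in> P" unfolding m_def by (rule LeastI) fact
  have "m \<le> k" unfolding m_def by (rule Least_le) fact
  have "m \<noteq> 0" "m \<noteq> deg" using m ends by metis+
  then obtain j where j: "m = Suc j" "m < deg" using \<open>m \<le> k\<close> \<open>k \<le> deg\<close> by (cases m) auto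
  have "y j c \<notin> P" using not_less_Least[of j "\<lambda>m. y m c \<in> P"] j by (simp add: m_def)
  have "y (deg - 1) c * y m c \<in> P"
    using mult_y_in_P(1)[OF m, of "deg - 1" c] c by simp
  moreover have "y j c * y deg c - y m c * y (deg - 1) c \<in> P"
    using row_exchange_in_P[of j "deg - 1" c] j c by simp
  ultimately have "y j c * y deg c \<in> P"
    using ideal_add[OF ideal_P'] by (fastforce simp: mult.commute)
  then show False
    using prime_P[of "y j c" "y deg c"] \<open>y j c \<notin> P\<close> ends y_in_carrier[of j c] y_in_carrier[of deg c] j c
    by auto
qed

text \<open>A row without zeros makes all rows proportional to geometric progressions with the same ratio.
  Multiplying the exchange binomial by two entries of that row turns it into a combination of binomials
  already known to be in \<open>P\<close>.\<close>

lemma exchange_ideal_of_full_row: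
  assumes g: "g \<in> {1..r 3}" and full: "\<And>k. k \<le> deg \<Longrightarrow> y k g \<notin> P"
  shows "exchange_ideal P"
  unfolding exchange_ideal_def
proof (intro conjI ballI allI impI ideal_P)
  fix k l c e assume kl: "k < deg" "l < deg" and ce: "c \<in> {1..r 3}" "e \<in> {1..r 3}"
  let ?d = "y k c * y (Suc l) e - y (Suc k) c * y l e"
  let ?A1 = "y k c * y (Suc k) g - y (Suc k) c * y k g"
  let ?A2 = "y l g * y (Suc l) e - y (Suc l) g * y l e"
  let ?A3 = "y k g * y (Suc l) g - y (Suc k) g * y l g"
  have "?A1 \<in> P" "?A2 \<in> P" "?A3 \<in> P"
    using adjacent_minor_in_P[of k c g] adjacent_minor_in_P[of l g e] row_exchange_in_P[of k l g] kl ce g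
    by auto
  then have "(y k c * y (Suc l) e) * ?A3 + (y k c * y (Suc k) g) * ?A2 + (y (Suc l) g * y l e) * ?A1 \<in> P"
    by (intro ideal_add[OF ideal_P'] ideal_mult[OF ideal_P'] carrier_mpoly_ring_closed y_carrier_P)
      (use kl ce g in simp_all)
  also have "(y k c * y (Suc l) e) * ?A3 + (y k c * y (Suc k) g) * ?A2 + (y (Suc l) g * y l e) * ?A1
      = y k g * (y (Suc l) g * ?d)"
    by (simp add: algebra_simps)
  finally have "y k g * (y (Suc l) g * ?d) \<in> P" .
  moreover have d: "?d \<in> carrier (Rng r)" and
    "y k g \<in> carrier (Rng r)" "y (Suc l) g \<in> carrier (Rng r)" "y (Suc l) g * ?d \<in> carrier (Rng r)"
    unfolding Rng_def
    by (intro carrier_mpoly_ring_closed y_carrier_P; use kl ce g in auto)+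
  ultimately show "?d \<in> P"
    using prime_P full kl by (meson Suc_leI less_imp_le)
qed

lemma exchange_ideal_of_low_rows:
  assumes "\<And>k c. 0 < k \<Longrightarrow> k \<le> deg \<Longrightarrow> c \<in> {1..r 3} \<Longrightarrow> y k c \<in> P"
  shows "exchange_ideal P"
  unfolding exchange_ideal_def
proof (intro conjI ballI allI impI ideal_P)
  fix k l c e assume kl: "k < deg" "l < deg" and ce: "c \<in> {1..r 3}" "e \<in> {1..r 3}"
  have "y k c * y (Suc l) e \<in> P" "y l e * y (Suc k) c \<in> P"
    by (rule mult_y_in_P; use kl ce assms in simp)+
  then show "y k c * y (Suc l) e - y (Suc k) c * y l e \<in> P"
    using ideal_diff[OF ideal_P'] by (simp add: mult.commute)
qed

lemma exchange_ideal_of_high_rows: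
  assumes "\<And>k c. k < deg \<Longrightarrow> c \<in> {1..r 3} \<Longrightarrow> y k c \<in> P"
  shows "exchange_ideal P"
  unfolding exchange_ideal_def
proof (intro conjI ballI allI impI ideal_P)
  fix k l c e assume kl: "k < deg" "l < deg" and ce: "c \<in> {1..r 3}" "e \<in> {1..r 3}"
  have "y (Suc l) e * y k c \<in> P" "y (Suc k) c * y l e \<in> P"
    by (rule mult_y_in_P; use kl ce assms in simp)+
  then show "y k c * y (Suc l) e - y (Suc k) c * y l e \<in> P"
    using ideal_diff[OF ideal_P'] by (simp add: mult.commute)
qed

lemma prime_above_I2:
  "I2_tilde r t \<subseteq> P \<or> (\<exists>\<phi>\<in>nonconst_phis r. P2 r t (S_phi r \<phi>) \<subseteq> P)"
proof (cases "exchange_ideal P")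
  case True
  then show ?thesis using I2_tilde_subset_exchange_ideal[OF t] by blast
next
  case False
  define low where "low c \<longleftrightarrow> (\<forall>k. 0 < k \<and> k \<le> deg \<longrightarrow> y k c \<in> P)" for c
  define high where "high c \<longleftrightarrow> (\<forall>k<deg. y k c \<in> P)" for c
  have low_high: "low c \<or> high c" if c: "c \<in> {1..r 3}" for c
  proof (rule ccontr)
    assume "\<not> ?thesis"
    then have "y deg c \<notin> P" "y 0 c \<notin> P"
      using row_low[OF c] row_high[OF c] unfolding low_def high_def by blast+
    then show False
      using exchange_ideal_of_full_row[OF c] row_full[OF c] False by blast
  qed
  \<comment> \<open>A zero row is both low and high; the two rows below exist because neither side supports all rows,
      and they make \<open>\<phi>\<close> nonconstant.\<close>
  obtain c1 where c1: "c1 \<in> {1..r 3}" "\<not> low c1"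
    using exchange_ideal_of_low_rows False unfolding low_def by blast
  obtain c2 where c2: "c2 \<in> {1..r 3}" "\<not> high c2"
    using exchange_ideal_of_high_rows False unfolding high_def by blast
  define \<phi> where "\<phi> = (\<lambda>c\<in>{1..r 3}. if low c then (1, 1) else (r 1, r 2))"
  have range: "\<phi> \<in> {1..r 3} \<rightarrow>\<^sub>E {(1, 1), (r 1, r 2)}"
    by (auto simp: \<phi>_def)
  have "\<phi> c1 \<noteq> \<phi> c2"
    using c1 c2 low_high r1 by (auto simp: \<phi>_def)
  then have "\<phi> \<in> nonconst_phis r"
    using range c1(1) c2(1) unfolding nonconst_phis_def by blast
  moreover have "P2 r t (S_phi r \<phi>) \<subseteq> P"
    unfolding P2_eq_genideal[OF range t]
  proof (rule ring.genideal_minimal[OF ring_Rng ideal_P], safe)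
    fix a assume a: "a \<in> idx r" "a \<notin> S_phi r \<phi>"
    obtain p q c where pqc: "a = triple p q c" "p \<in> {1..r 1}" "q \<in> {1..r 2}" "c \<in> {1..r 3}"
      using a(1) idxE by blast
    have "p + q - 2 \<noteq> level \<phi> c"
      using a triple_in_S_phi[OF range pqc(2-)] pqc(1) by simp
    moreover have "level \<phi> c = (if low c then 0 else deg)"
      using pqc by (simp add: level_def \<phi>_def deg_def)
    ultimately have "y (p + q - 2) c \<in> P"
      using low_high[OF pqc(4)] pqc r1 r2 unfolding low_def high_def deg_def
      by (auto split: if_splits)
    then show "xv r a \<in> P"
      using a(1) pqc by (simp add: xv_triple)
  qed
  ultimately show ?thesis by blast
qed

end

section \<open>Minimality and the number of components\<close>

lemma primeideal_I2_tilde: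
  assumes t: "t \<in> {1..3}"
  shows "primeideal (I2_tilde r t :: ((nat \<Rightarrow> nat) set, 'k::field) mpoly set) (Rng r)"
  unfolding I2_tilde_eq_kernel[OF t] Rng_def by (rule primeideal_eval_kernel)

lemma primeideal_P2:
  assumes t: "t \<in> {1..3}" and \<phi>: "\<phi> \<in> {1..r 3} \<rightarrow>\<^sub>E {(1, 1), (r 1, r 2)}"
  shows "primeideal (P2 r t (S_phi r \<phi>) :: ((nat \<Rightarrow> nat) set, 'k::field) mpoly set) (Rng r)"
  unfolding P2_eq_kernel[OF \<phi> t] Rng_def by (rule primeideal_eval_kernel)

lemma single_one_neq_0: "Poly_Mapping.single m (1::'k::field) \<noteq> 0"
  by (metis keys_single keys_zero insert_not_empty zero_neq_one)

lemma P2_not_subset_I2_tilde: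
  assumes t: "t \<in> {1..3}" and \<phi>: "\<phi> \<in> {1..r 3} \<rightarrow>\<^sub>E {(1, 1), (r 1, r 2)}"
  shows "\<not> (P2 r t (S_phi r \<phi>) :: ((nat \<Rightarrow> nat) set, 'k::field) mpoly set) \<subseteq> I2_tilde r t"
proof
  assume sub: "(P2 r t (S_phi r \<phi>) :: ((nat \<Rightarrow> nat) set, 'k) mpoly set) \<subseteq> I2_tilde r t"
  \<comment> \<open>Column \<open>1\<close> is strictly between the corners, so \<open>y 1 1\<close> survives only in the toric map.\<close>
  have g: "(1, 1) \<in> grid" using r1 r2 r3 by (simp add: deg_def)
  have "level \<phi> 1 \<noteq> 1"
    using level_cases[OF \<phi>, of 1] r1 r2 r3 by (auto simp: deg_def)
  then have "(y 1 1 :: ((nat \<Rightarrow> nat) set, 'k) mpoly) \<in> P2 r t (S_phi r \<phi>)"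
    unfolding P2_eq_kernel[OF \<phi> t] using eval_corner_y[where 'k = 'k, OF g] y_in_carrier[OF g] by simp
  then have "mpoly_eval toric (y 1 1 :: ((nat \<Rightarrow> nat) set, 'k) mpoly) = 0"
    using sub unfolding I2_tilde_eq_kernel[OF t] by blast
  then show False
    using eval_toric_y[where 'k = 'k, OF g] single_one_neq_0 by metis
qed

lemma I2_tilde_not_subset_P2:
  assumes t: "t \<in> {1..3}" and \<phi>: "\<phi> \<in> nonconst_phis r"
  shows "\<not> I2_tilde r t \<subseteq> (P2 r t (S_phi r \<phi>) :: ((nat \<Rightarrow> nat) set, 'k::field) mpoly set)"
proof
  assume sub: "I2_tilde r t \<subseteq> (P2 r t (S_phi r \<phi>) :: ((nat \<Rightarrow> nat) set, 'k::field) mpoly set)"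
  have range: "\<phi> \<in> {1..r 3} \<rightarrow>\<^sub>E {(1, 1), (r 1, r 2)}"
    using \<phi> by (simp add: nonconst_phis_def)
  obtain c c' where "c \<in> {1..r 3}" "c' \<in> {1..r 3}" "\<phi> c \<noteq> \<phi> c'"
    using \<phi> by (auto simp: nonconst_phis_def)
  then obtain c e where ce: "c \<in> {1..r 3}" "e \<in> {1..r 3}" "\<phi> c = (1, 1)" "\<phi> e = (r 1, r 2)"
    using phi_cases[OF range] by metis
  then have lev: "level \<phi> c = 0" "level \<phi> e = deg" by (simp_all add: level_def deg_def)
  \<comment> \<open>One exchange replaces two surviving corner variables by variables strictly between the corners.\<close>
  have deg: "0 < deg" "1 < deg" using r1 r2 by (auto simp: deg_def)
  have "\<forall>k<deg. \<forall>l<deg. y k c * y (Suc l) e - y (Suc k) c * y l e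
      \<in> (I2_tilde r t :: ((nat \<Rightarrow> nat) set, 'k) mpoly set)"
    using exchange_ideal_I2_tilde[where 'k = 'k, OF t] ce by (auto simp: exchange_ideal_def)
  from this[rule_format, of 0 "deg - 1"]
  have "y 0 c * y (Suc (deg - 1)) e - y (Suc 0) c * y (deg - 1) e
      \<in> (I2_tilde r t :: ((nat \<Rightarrow> nat) set, 'k) mpoly set)"
    using deg by simp
  then have "mpoly_eval (corner \<phi>) (y 0 c * y deg e - y 1 c * y (deg - 1) e
      :: ((nat \<Rightarrow> nat) set, 'k) mpoly) = 0"
    using sub deg unfolding P2_eq_kernel[OF range t] by auto
  moreover have "mpoly_eval (corner \<phi>) (y 0 c * y deg e - y 1 c * y (deg - 1) e
      :: ((nat \<Rightarrow> nat) set, 'k) mpoly)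
      = Poly_Mapping.single (Poly_Mapping.single c 1 + Poly_Mapping.single e 1) 1"
    using ce lev deg by (simp add: mpoly_eval_diff mpoly_eval_mult eval_corner_y mult_single)
  ultimately show False using single_one_neq_0 by metis
qed

text \<open>In a row where \<open>\<phi>\<close> and \<open>\<psi>\<close> differ, the corner variable chosen by \<open>\<psi>\<close> lies in the first ideal
  only.\<close>

lemma P2_subset_imp_eq:
  assumes t: "t \<in> {1..3}"
    and \<phi>: "\<phi> \<in> {1..r 3} \<rightarrow>\<^sub>E {(1, 1), (r 1, r 2)}" and \<psi>: "\<psi> \<in> {1..r 3} \<rightarrow>\<^sub>E {(1, 1), (r 1, r 2)}"
    and sub: "P2 r t (S_phi r \<phi>) \<subseteq> (P2 r t (S_phi r \<psi>) :: ((nat \<Rightarrow> nat) set, 'k::field) mpoly set)"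
  shows "\<phi> = \<psi>"
proof (rule PiE_ext[OF \<phi> \<psi>], rule ccontr)
  fix c assume c: "c \<in> {1..r 3}" and neq: "\<phi> c \<noteq> \<psi> c"
  let ?a = "triple (fst (\<psi> c)) (snd (\<psi> c)) c"
  have a: "?a \<in> idx r" using phi_cases[OF \<psi> c] c r1 r2 by auto
  have "xv r ?a \<in> (P2 r t (S_phi r \<phi>) :: ((nat \<Rightarrow> nat) set, 'k) mpoly set)"
    unfolding P2_eq_kernel[OF \<phi> t] using eval_corner_xv_eq_0_iff[OF \<phi> a] xv_in_carrier[OF a] neq
    by (simp add: S_phi_def)
  then have "mpoly_eval (corner \<psi>) (xv r ?a :: ((nat \<Rightarrow> nat) set, 'k) mpoly) = 0"
    using sub unfolding P2_eq_kernel[OF \<psi> t] by blast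
  then show False
    using eval_corner_xv_eq_0_iff[OF \<psi> a, where 'k = 'k] a by (simp add: S_phi_def)
qed

lemma card_nonconst_phis: "finite (nonconst_phis r)" "card (nonconst_phis r) = 2 ^ r 3 - 2"
proof -
  let ?F = "{1..r 3} \<rightarrow>\<^sub>E {(1, 1), (r 1, r 2)}"
  let ?lo = "\<lambda>c\<in>{1..r 3}. (1::nat, 1::nat)" and ?hi = "\<lambda>c\<in>{1..r 3}. (r 1, r 2)"
  have fin: "finite ?F" by (intro finite_PiE) auto
  have "card ?F = (\<Prod>c\<in>{1..r 3}. card {(1, 1), (r 1, r 2)})"
    by (rule card_PiE) simp
  then have card: "card ?F = 2 ^ r 3"
    using r1 by (simp add: numeral_2_eq_2)
  have "nonconst_phis r = ?F - {?lo, ?hi}"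
  proof (intro equalityI subsetI)
    fix \<phi> assume \<phi>: "\<phi> \<in> nonconst_phis r"
    then have "\<phi> \<noteq> ?lo" "\<phi> \<noteq> ?hi" by (auto simp: nonconst_phis_def)
    then show "\<phi> \<in> ?F - {?lo, ?hi}" using \<phi> by (simp add: nonconst_phis_def)
  next
    fix \<phi> assume \<phi>: "\<phi> \<in> ?F - {?lo, ?hi}"
    then have range: "\<phi> \<in> ?F" by blast
    have one: "1 \<in> {1..r 3}" using r3 by simp
    have "\<exists>c\<in>{1..r 3}. \<phi> c \<noteq> \<phi> 1"
    proof (rule ccontr)
      assume *: "\<not> ?thesis"
      have "\<phi> = (\<lambda>c\<in>{1..r 3}. \<phi> 1)"
      proof
        fix c show "\<phi> c = (\<lambda>c\<in>{1..r 3}. \<phi> 1) c"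
        proof (cases "c \<in> {1..r 3}")
          case True
          then show ?thesis using * by (simp only: restrict_apply') blast
        next
          case False
          then show ?thesis using PiE_arb[OF range] by (simp only: restrict_def if_False)
        qed
      qed
      moreover have "\<phi> \<noteq> ?lo" "\<phi> \<noteq> ?hi" using \<phi> by blast+
      ultimately show False using phi_cases[OF range one] by metis
    qed
    then show "\<phi> \<in> nonconst_phis r"
      using range one unfolding nonconst_phis_def by blast
  qed
  moreover have "?lo \<noteq> ?hi"
  proof
    assume "?lo = ?hi"
    then have "fst (?lo 1) = fst (?hi 1)" by (simp only:)
    then show False using r1 r3 by simp
  qed
  moreover have "?lo \<in> ?F" "?hi \<in> ?F" by auto
  ultimately show "finite (nonconst_phis r)" "card (nonconst_phis r) = 2 ^ r 3 - 2"
    using fin card by (auto simp: card_Diff_subset)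
qed

end

lemma minimal_primes_eqI:
  assumes "\<And>P. P \<in> F \<Longrightarrow> primeideal P R \<and> I \<subseteq> P"
    and "\<And>Q. primeideal Q R \<Longrightarrow> I \<subseteq> Q \<Longrightarrow> \<exists>P\<in>F. P \<subseteq> Q"
    and "\<And>P Q. P \<in> F \<Longrightarrow> Q \<in> F \<Longrightarrow> P \<subseteq> Q \<Longrightarrow> P = Q"
  shows "minimal_primes R I = F"
proof (intro Set.set_eqI iffI)
  fix P assume "P \<in> minimal_primes R I"
  then have P: "primeideal P R" "I \<subseteq> P" and min: "\<And>Q. primeideal Q R \<Longrightarrow> I \<subseteq> Q \<Longrightarrow> Q \<subseteq> P \<Longrightarrow> Q = P"
    by (simp_all add: minimal_primes_def)
  obtain Q where Q: "Q \<in> F" "Q \<subseteq> P"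
    using assms(2)[OF P] by blast
  then have "Q = P"
    using min assms(1)[OF Q(1)] by simp
  then show "P \<in> F" using Q(1) by simp
next
  fix P assume P: "P \<in> F"
  have "Q = P" if "primeideal Q R" "I \<subseteq> Q" "Q \<subseteq> P" for Q
    using assms(2)[OF that(1,2)] assms(3) P that(3) by blast
  then show "P \<in> minimal_primes R I"
    using assms(1)[OF P] unfolding minimal_primes_def by blast
qed

theorem theorem5p12:
  fixes r :: "nat \<Rightarrow> nat" and t :: nat
  assumes "r 1 \<ge> 2" and "r 2 \<ge> 2" and "r 3 \<ge> 2" and "t \<in> {1..3}"
  shows "minimal_primes (Rng r) (I2 r t :: ((nat \<Rightarrow> nat) set, 'k::field) mpoly set) =
           {I2_tilde r t} \<union> {P2 r t (S_phi r \<phi>) | \<phi>. \<phi> \<in> nonconst_phis r} \<and>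
         card (minimal_primes (Rng r) (I2 r t :: ((nat \<Rightarrow> nat) set, 'k) mpoly set)) =
           2 ^ r 3 - 1 \<and>
         (\<forall>\<phi> \<in> nonconst_phis r.
           monomial_ideal (variables r)
             (P2 r t (S_phi r \<phi>) :: ((nat \<Rightarrow> nat) set, 'k) mpoly set))"
proof -
  interpret box r using assms by unfold_locales
  note t = assms(4)
  let ?T = "I2_tilde r t :: ((nat \<Rightarrow> nat) set, 'k) mpoly set"
  let ?P = "\<lambda>\<phi>. P2 r t (S_phi r \<phi>) :: ((nat \<Rightarrow> nat) set, 'k) mpoly set"
  have range: "\<phi> \<in> {1..r 3} \<rightarrow>\<^sub>E {(1, 1), (r 1, r 2)}" if "\<phi> \<in> nonconst_phis r" for \<phi>
    using that by (simp add: nonconst_phis_def)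
  have minimal: "minimal_primes (Rng r) (I2 r t) = insert ?T (?P ` nonconst_phis r)"
  proof (rule minimal_primes_eqI)
    fix P assume "P \<in> insert ?T (?P ` nonconst_phis r)"
    then show "primeideal P (Rng r) \<and> I2 r t \<subseteq> P"
      using primeideal_I2_tilde[where 'k = 'k, OF t] I2_subset_I2_tilde[where 'k = 'k, OF t]
        primeideal_P2[OF t range] I2_subset_P2[OF range t] by auto
  next
    fix Q :: "((nat \<Rightarrow> nat) set, 'k) mpoly set"
    assume "primeideal Q (Rng r)" "I2 r t \<subseteq> Q"
    from prime_above_I2[OF t this] show "\<exists>P\<in>insert ?T (?P ` nonconst_phis r). P \<subseteq> Q"
      by (elim disjE bexE) blast+
  next
    fix P Q assume "P \<in> insert ?T (?P ` nonconst_phis r)" "Q \<in> insert ?T (?P ` nonconst_phis r)" "P \<subseteq> Q"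
    then show "P = Q"
      using P2_not_subset_I2_tilde[where 'k = 'k, OF t range] I2_tilde_not_subset_P2[where 'k = 'k, OF t]
        P2_subset_imp_eq[where 'k = 'k, OF t range range] by blast
  qed
  have "inj_on ?P (nonconst_phis r)"
    using P2_subset_imp_eq[where 'k = 'k, OF t range range] by (intro inj_onI) blast
  moreover have "?T \<notin> ?P ` nonconst_phis r"
    using I2_tilde_not_subset_P2[where 'k = 'k, OF t] by blast
  ultimately have "card (insert ?T (?P ` nonconst_phis r)) = Suc (2 ^ r 3 - 2)"
    using card_nonconst_phis by (simp add: card_image)
  moreover have "2 \<le> (2::nat) ^ r 3"
    using assms(3) power_increasing[of 1 "r 3" "2::nat"] by simp
  ultimately have "card (insert ?T (?P ` nonconst_phis r)) = 2 ^ r 3 - 1"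
    by simp
  then show ?thesis
    unfolding minimal using monomial_ideal_P2[OF range t] by auto
qed

end
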